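(* Let $r_0>0$, $v_\infty\in\mathbb{R}$, $\mathbf{v}_\infty=(v_\infty,0)$ and $B_{r_0}=\{\mathbf{x}\in\mathbb{R}^2:|\mathbf{x}|>r_0\}$. Let the initial vector field $\mathbf{v}_0(\mathbf{x})$ on $B_{r_0}$ satisfy $\operatorname{div}\mathbf{v}_0=0$, $\mathbf{v}_0(\mathbf{x})=0$ for $|\mathbf{x}|=r_0$, $\mathbf{v}_0(\mathbf{x})\to\mathbf{v}_\infty$ as $|\mathbf{x}|\to\infty$, $\lim_{R\to\infty}\oint_{|\mathbf{x}|=R}\mathbf{v}_0\cdot d\mathbf{l}=0$, and $\operatorname{curl}\mathbf{v}_0\in L_1(B_{r_0})$. Suppose that the Fourier series (in the polar angle) of $\mathbf{v}_0$ and of $\operatorname{curl}\mathbf{v}_0$ converge and that the Fourier coefficients $w_k^0(r)$ of $\operatorname{curl}\mathbf{v}_0$ satisfy $w_k^0(r)\sqrt r\in L_1(r_0,\infty)$, $k\in\mathbb{Z}$. Then the Fourier coefficients $w_k(t,r)$ of the solution $w(t,\mathbf{x})$ of $$\partial_tw-\Delta w=0\text{ in }B_{r_0},\qquad w(0,\mathbf{x})=\operatorname{curl}\mathbf{v}_0(\mathbf{x}),\qquad \operatorname{curl}^{-1}w(t,\mathbf{x})\big|_{|\mathbf{x}|=r_0}=0,\qquad w(t,\mathbf{x})\to0\text{ as }|\mathbf{x}|\to\infty$$ satisfy the Robin-type condition $$r_0\frac{\partial w_k(t,r)}{\partial r}\Big|_{r=r_0}+|k|\,w_k(t,r_0)=0,\qquad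 k\in\mathbb{Z}.$$
   Context: Here $\operatorname{curl}\mathbf{v}=\partial_{x_1}v_2-\partial_{x_2}v_1$, and $(r,\varphi)$ are polar coordinates. Fourier coefficients: for a scalar function, $f_k(r)=\frac1{2\pi}\int_0^{2\pi}f(r,\varphi)e^{-ik\varphi}d\varphi$; for a vector field the same is applied to its radial and tangential components. The notation $\operatorname{curl}^{-1}w(t,\cdot)$ denotes the velocity field $\mathbf{v}(t,\cdot)$ recovered from its vorticity: $\operatorname{div}\mathbf{v}=0$, $\operatorname{curl}\mathbf{v}=w$ in $B_{r_0}$, $\mathbf{v}\to\mathbf{v}_\infty$ at infinity; so the condition $\operatorname{curl}^{-1}w|_{|\mathbf{x}|=r_0}=0$ is the no-slip condition, i.e. this velocity field vanishes on $|\mathbf{x}|=r_0$. Throughout, the velocity is assumed to have zero circulation at infinity: $\lim_{R\to\infty}\oint_{|\mathbf{x}|=R}\mathbf{v}\cdot d\mathbf{l}=0$. *)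

theory Defs
  imports "HOL-Analysis.Analysis"
begin

definition exterior_dom :: "real \<Rightarrow> (real^2) set" where
  "exterior_dom r0 = {x. norm x > r0}"

definition closed_exterior :: "real \<Rightarrow> (real^2) set" where
  "closed_exterior r0 = {x. norm x \<ge> r0}"

text \<open>Partial derivatives are read off the total derivative, so they are meaningful only where
  \<open>f\<close> is differentiable; every use below comes with a differentiability assumption.\<close>

definition pd :: "2 \<Rightarrow> (real^2 \<Rightarrow> real) \<Rightarrow> real^2 \<Rightarrow> real" where
  "pd j f x = frechet_derivative f (at x) (axis j 1)"

definition div2 :: "(real^2 \<Rightarrow> real^2) \<Rightarrow> real^2 \<Rightarrow> real" where
  "div2 v x = pd 1 (\<lambda>y. v y $ 1) x + pd 2 (\<lambda>y. v y $ 2) x"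

definition curl2 :: "(real^2 \<Rightarrow> real^2) \<Rightarrow> real^2 \<Rightarrow> real" where
  "curl2 v x = pd 1 (\<lambda>y. v y $ 2) x - pd 2 (\<lambda>y. v y $ 1) x"

definition laplacian2 :: "(real^2 \<Rightarrow> real) \<Rightarrow> real^2 \<Rightarrow> real" where
  "laplacian2 f x = pd 1 (pd 1 f) x + pd 2 (pd 2 f) x"

definition polar :: "real \<Rightarrow> real \<Rightarrow> real^2" where
  "polar r \<phi> = vector [r * cos \<phi>, r * sin \<phi>]"

definition radial_comp :: "(real^2 \<Rightarrow> real^2) \<Rightarrow> real^2 \<Rightarrow> real" where
  "radial_comp v x = (x $ 1 * v x $ 1 + x $ 2 * v x $ 2) / norm x"

definition tangential_comp :: "(real^2 \<Rightarrow> real^2) \<Rightarrow> real^2 \<Rightarrow> real" where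
  "tangential_comp v x = (x $ 1 * v x $ 2 - x $ 2 * v x $ 1) / norm x"

definition fourier_coeff :: "int \<Rightarrow> (real^2 \<Rightarrow> real) \<Rightarrow> real \<Rightarrow> complex" where
  "fourier_coeff k f r =
     complex_of_real (1 / (2 * pi)) *
     integral {0..2*pi} (\<lambda>\<phi>. complex_of_real (f (polar r \<phi>)) * cis (- (real_of_int k * \<phi>)))"

definition fourier_series_converges :: "(real^2 \<Rightarrow> real) \<Rightarrow> real \<Rightarrow> bool" where
  "fourier_series_converges f r \<longleftrightarrow>
     (\<lambda>\<phi>. f (polar r \<phi>)) absolutely_integrable_on {0..2*pi} \<and>
     (\<forall>\<phi>. convergent (\<lambda>N. \<Sum>k = - int N..int N. fourier_coeff k f r * cis (real_of_int k * \<phi>)))"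

text \<open>The circulation along \<open>|x| = R\<close>, oriented counterclockwise, with \<open>dl = R e\<^sub>\<phi> d\<phi>\<close>.\<close>

definition circulation :: "(real^2 \<Rightarrow> real^2) \<Rightarrow> real \<Rightarrow> real" where
  "circulation v R = integral {0..2*pi} (\<lambda>\<phi>. tangential_comp v (polar R \<phi>) * R)"

text \<open>A solenoidal field in the exterior of the disc with the prescribed velocity
  \<open>(vinf, 0)\<close> and zero circulation at infinity. Continuity up to the circle gives boundary
  values their meaning.\<close>

definition exterior_flow :: "real \<Rightarrow> real \<Rightarrow> (real^2 \<Rightarrow> real^2) \<Rightarrow> bool" where
  "exterior_flow r0 vinf v \<longleftrightarrow>
     continuous_on (closed_exterior r0) v \<and>
     (\<forall>x\<in>exterior_dom r0. v differentiable (at x)) \<and>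
     (\<forall>x\<in>exterior_dom r0. div2 v x = 0) \<and>
     (v \<longlongrightarrow> vector [vinf, 0]) at_infinity \<and>
     (circulation v \<longlongrightarrow> 0) at_top"

definition vanishes_on_circle :: "real \<Rightarrow> (real^2 \<Rightarrow> real^2) \<Rightarrow> bool" where
  "vanishes_on_circle r0 v \<longleftrightarrow> (\<forall>x. norm x = r0 \<longrightarrow> v x = 0)"

text \<open>\<open>v\<close> is a velocity field recovered from the vorticity \<open>\<omega>\<close>. This is a relation, since
  without a boundary condition the field is determined only up to potential flows decaying at
  infinity; at most one such field vanishes on the circle.\<close>

definition curl_inverse :: "real \<Rightarrow> real \<Rightarrow> (real^2 \<Rightarrow> real) \<Rightarrow> (real^2 \<Rightarrow> real^2) \<Rightarrow> bool" where
  "curl_inverse r0 vinf \<omega> v \<longleftrightarrow>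
     exterior_flow r0 vinf v \<and>
     (\<forall>i j. continuous_on (exterior_dom r0) (pd j (\<lambda>x. v x $ i))) \<and>
     (\<forall>x\<in>exterior_dom r0. curl2 v x = \<omega> x)"

definition no_slip_vorticity :: "real \<Rightarrow> real \<Rightarrow> (real^2 \<Rightarrow> real) \<Rightarrow> bool" where
  "no_slip_vorticity r0 vinf \<omega> \<longleftrightarrow> (\<exists>v. curl_inverse r0 vinf \<omega> v \<and> vanishes_on_circle r0 v)"

text \<open>Classical solutions for positive times: once continuously differentiable in \<open>t\<close> and twice
  in \<open>x\<close> inside the domain; \<open>w\<close> and its gradient are continuous up to the circle (\<open>g j\<close> being the
  continuous extension of the \<open>j\<close>-th partial derivative).\<close>

definition heat_solution :: "real \<Rightarrow> (real \<Rightarrow> real^2 \<Rightarrow> real) \<Rightarrow> bool" where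
  "heat_solution r0 w \<longleftrightarrow>
     (\<forall>t>0. \<forall>x\<in>exterior_dom r0.
        (\<lambda>s. w s x) differentiable (at t) \<and>
        w t differentiable (at x) \<and>
        (\<forall>j. pd j (w t) differentiable (at x))) \<and>
     continuous_on ({0<..} \<times> exterior_dom r0) (\<lambda>(t, x). deriv (\<lambda>s. w s x) t) \<and>
     (\<forall>i j. continuous_on ({0<..} \<times> exterior_dom r0) (\<lambda>(t, x). pd i (pd j (w t)) x)) \<and>
     continuous_on ({0<..} \<times> closed_exterior r0) (\<lambda>(t, x). w t x) \<and>
     (\<exists>g. \<forall>j. continuous_on ({0<..} \<times> closed_exterior r0) (\<lambda>(t, x). g j t x) \<and>
        (\<forall>t>0. \<forall>x\<in>exterior_dom r0. g j t x = pd j (w t) x)) \<and>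
     (\<forall>t>0. \<forall>x\<in>exterior_dom r0. deriv (\<lambda>s. w s x) t - laplacian2 (w t) x = 0)"

text \<open>The initial value is attained in the local \<open>L\<^sub>1\<close> sense, which is implied by continuity of
  \<open>w\<close> down to \<open>t = 0\<close> but does not require \<open>w0\<close> to be continuous.\<close>

definition has_initial_value ::
  "real \<Rightarrow> (real \<Rightarrow> real^2 \<Rightarrow> real) \<Rightarrow> (real^2 \<Rightarrow> real) \<Rightarrow> bool" where
  "has_initial_value r0 w w0 \<longleftrightarrow>
     (\<forall>x\<in>exterior_dom r0. w 0 x = w0 x) \<and>
     (\<forall>K. compact K \<and> K \<subseteq> exterior_dom r0 \<longrightarrow>
        ((\<lambda>t. integral K (\<lambda>x. \<bar>w t x - w0 x\<bar>)) \<longlongrightarrow> 0) (at_right 0))"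

end

(* Fix k >= 0 and let w_k be the k-th Fourier coefficient of the vorticity. Integrating div v = 0 and
   curl v = w against r^(-k) e^(-ik phi) shows that the moments of w_k with weight s^(1-k) over (r0, r)
   are boundary terms of the velocity; no-slip kills the one at r0, and the one at infinity depends on
   the prescribed limit only. Hence the moment over (r0, infinity) does not depend on t. Its time
   derivative is the difference of the fluxes F = r^(1-k) (d/dr w_k + k w_k / r) at infinity and at
   r0, so F vanishes at r0 if the flux at infinity does.

   Decay of w(t, x) in x is assumed for each t separately, hence the flux at infinity is controlled
   only on time intervals where w is bounded for large |x|. There a nonzero mean of F in time would
   make the mean of w_k unbounded. By Baire's theorem such intervals are dense, and F(., r0) is
   continuous, so it vanishes identically. Negative k follow by conjugation. *)

theory Submission
  imports Defs
begin

section \<open>Polar coordinates on the exterior domain and derivatives along them\<close>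

lemma polar_nth [simp]: "polar r \<phi> $ 1 = r * cos \<phi>" "polar r \<phi> $ 2 = r * sin \<phi>"
  by (simp_all add: polar_def)

lemma norm_polar [simp]: "norm (polar r \<phi>) = \<bar>r\<bar>"
proof -
  have "norm (polar r \<phi>) = sqrt (r\<^sup>2 * ((cos \<phi>)\<^sup>2 + (sin \<phi>)\<^sup>2))"
    unfolding norm_vec_def L2_set_def sum_2 by (simp add: power_mult_distrib distrib_left del: sin_cos_squared_add sin_cos_squared_add2)
  then show ?thesis by (simp only: sin_cos_squared_add2) simp
qed

lemma vec2_eq: "(x::real^2) = x $ 1 *\<^sub>R axis 1 1 + x $ 2 *\<^sub>R axis 2 1"
  by (simp add: vec_eq_iff forall_2 axis_def)

lemma polar_eq_axis: "polar r \<phi> = (r * cos \<phi>) *\<^sub>R axis 1 1 + (r * sin \<phi>) *\<^sub>R axis 2 1"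
  using vec2_eq[of "polar r \<phi>"] by simp

lemma continuous_on_polar [continuous_intros]:
  assumes "continuous_on S f" "continuous_on S g"
  shows "continuous_on S (\<lambda>x. polar (f x) (g x))"
  unfolding polar_eq_axis
  by (intro continuous_intros assms continuous_on_compose2[OF _ assms(2)] continuous_on_cos_real) auto

lemma polar_in_exterior [simp]: "0 < r0 \<Longrightarrow> r0 < r \<Longrightarrow> polar r \<phi> \<in> exterior_dom r0"
  by (simp add: exterior_dom_def)

lemma polar_in_closed_exterior [simp]:
  "0 < r0 \<Longrightarrow> r0 \<le> r \<Longrightarrow> polar r \<phi> \<in> closed_exterior r0"
  by (simp add: closed_exterior_def)

lemma exterior_subset_closed: "exterior_dom r0 \<subseteq> closed_exterior r0"
  by (auto simp: exterior_dom_def closed_exterior_def)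

text \<open>Packed as a vector field so that \<open>radial_comp\<close> and
  \<open>tangential_comp\<close> apply to it: where \<open>f\<close> is differentiable, away from
  the origin, they give the radial derivative and \<open>1 / r\<close> times the angular
  derivative.\<close>

definition grad2 :: "(real^2 \<Rightarrow> real) \<Rightarrow> real^2 \<Rightarrow> real^2" where
  "grad2 f x = vector [pd 1 f x, pd 2 f x]"

lemma grad2_nth [simp]: "grad2 f x $ 1 = pd 1 f x" "grad2 f x $ 2 = pd 2 f x"
  by (simp_all add: grad2_def)

lemma frechet_derivative_eq_pd:
  assumes "f differentiable (at x)"
  shows "frechet_derivative f (at x) h = h $ 1 * pd 1 f x + h $ 2 * pd 2 f x"
proof -
  interpret linear "frechet_derivative f (at x)"
    by (rule linear_frechet_derivative[OF assms])
  show ?thesis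
    by (subst vec2_eq[of h]) (simp add: add scale pd_def)
qed

lemma has_vector_derivative_polar_radius:
  assumes "f differentiable (at (polar r \<phi>))" "r > 0"
  shows "((\<lambda>r. f (polar r \<phi>)) has_vector_derivative radial_comp (grad2 f) (polar r \<phi>)) (at r)"
proof -
  have "((\<lambda>r. polar r \<phi>) has_derivative (\<lambda>h. polar h \<phi>)) (at r)"
    unfolding polar_eq_axis by (auto intro!: derivative_eq_intros)
  then have "((\<lambda>r. f (polar r \<phi>)) has_derivative
      (\<lambda>h. frechet_derivative f (at (polar r \<phi>)) (polar h \<phi>))) (at r)"
    using assms(1)[unfolded frechet_derivative_works] by (rule has_derivative_compose)
  then show ?thesis
    unfolding has_vector_derivative_def
    by (rule has_derivative_eq_rhs)
      (use assms in \<open>auto simp: frechet_derivative_eq_pd radial_comp_def fun_eq_iff field_simps\<close>)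
qed

lemma has_vector_derivative_polar_angle:
  assumes "f differentiable (at (polar r \<phi>))" "r > 0"
  shows "((\<lambda>\<phi>. f (polar r \<phi>)) has_vector_derivative r * tangential_comp (grad2 f) (polar r \<phi>)) (at \<phi>)"
proof -
  have "((\<lambda>\<phi>. polar r \<phi>) has_derivative
      (\<lambda>h. (- r * sin \<phi> * h) *\<^sub>R axis 1 1 + (r * cos \<phi> * h) *\<^sub>R axis 2 1)) (at \<phi>)"
    unfolding polar_eq_axis by (auto intro!: derivative_eq_intros simp: fun_eq_iff mult.assoc mult.commute mult.left_commute)
  then have "((\<lambda>\<phi>. f (polar r \<phi>)) has_derivative
      (\<lambda>h. frechet_derivative f (at (polar r \<phi>))
        ((- r * sin \<phi> * h) *\<^sub>R axis 1 1 + (r * cos \<phi> * h) *\<^sub>R axis 2 1))) (at \<phi>)"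
    using assms(1)[unfolded frechet_derivative_works] by (rule has_derivative_compose)
  then show ?thesis
    unfolding has_vector_derivative_def
    by (rule has_derivative_eq_rhs)
      (use assms in \<open>auto simp: frechet_derivative_eq_pd tangential_comp_def fun_eq_iff axis_def field_simps\<close>)
qed

section \<open>Fourier coefficients: continuity, symmetry, bounds and linearity\<close>

text \<open>Continuity is joint in parameter and radius because time integrals of coefficients are
  later differentiated in the radius under the integral sign.\<close>

lemma continuous_on_fourier_coeff_param:
  fixes f :: "'a::topological_space \<Rightarrow> real^2 \<Rightarrow> real"
  assumes "continuous_on (T \<times> D) (\<lambda>(t, x). f t x)" "\<And>r \<phi>. r \<in> S \<Longrightarrow> polar r \<phi> \<in> D"
  shows "continuous_on (T \<times> S) (\<lambda>(t, r). fourier_coeff k (f t) r)"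
proof -
  have "continuous_on (T \<times> S) (\<lambda>p. integral (cbox 0 (2*pi))
      (\<lambda>\<phi>. complex_of_real (f (fst p) (polar (snd p) \<phi>)) * cis (- (real_of_int k * \<phi>))))"
  proof (rule integral_continuous_on_param)
    have "continuous_on ((T \<times> S) \<times> cbox 0 (2*pi))
      (\<lambda>q. (\<lambda>(t,x). f t x) (fst (fst q), polar (snd (fst q)) (snd q)))"
      by (rule continuous_on_compose2[OF assms(1)])
        (use assms(2) in \<open>auto intro!: continuous_intros\<close>)
    then show "continuous_on ((T \<times> S) \<times> cbox 0 (2*pi))
      (\<lambda>(p, \<phi>). complex_of_real (f (fst p) (polar (snd p) \<phi>)) * cis (- (real_of_int k * \<phi>)))"
      unfolding split_beta by (intro continuous_intros) simp
  qed
  then show ?thesis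
    unfolding fourier_coeff_def split_beta by (intro continuous_intros) (simp add: cbox_interval)
qed

lemma continuous_on_fourier_coeff:
  assumes "continuous_on D f" "\<And>r \<phi>. r \<in> S \<Longrightarrow> polar r \<phi> \<in> D"
  shows "continuous_on S (fourier_coeff k f)"
proof -
  \<comment> \<open>A dummy real parameter, later frozen at \<open>0\<close>, reduces this to the
    parametrised version.\<close>
  have "continuous_on (UNIV \<times> D) (\<lambda>(t::real, x). f x)"
    unfolding split_beta by (rule continuous_on_compose2[OF assms(1)]) (auto intro!: continuous_intros)
  from continuous_on_fourier_coeff_param[OF this assms(2)]
  have "continuous_on (UNIV \<times> S) (\<lambda>(t::real, r). fourier_coeff k f r)" by simp
  then have "continuous_on S (\<lambda>r. (\<lambda>(t, r). fourier_coeff k f r) (0::real, r))"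
    by (rule continuous_on_compose2) (auto intro!: continuous_intros)
  then show ?thesis by simp
qed

lemma fourier_coeff_integrable:
  assumes "continuous_on D f" "\<And>\<phi>. polar r \<phi> \<in> D"
  shows "(\<lambda>\<phi>. complex_of_real (f (polar r \<phi>)) * cis (- (real_of_int k * \<phi>))) integrable_on {0..2*pi}"
  by (intro integrable_continuous_real continuous_intros continuous_on_compose2[OF assms(1)])
     (use assms(2) in auto)

text \<open>Since \<open>f\<close> is real-valued, conjugation reverses the sign of the frequency.
  This carries results from nonnegative to negative \<open>k\<close> and shows that the zeroth
  coefficient is real.\<close>

lemma fourier_coeff_uminus: "fourier_coeff (- k) f r = cnj (fourier_coeff k f r)"
  unfolding fourier_coeff_def by (simp add: integral_cnj cis_cnj)

lemma norm_fourier_coeff_le: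
  assumes "continuous_on D f" "\<And>\<phi>. polar r \<phi> \<in> D" "\<And>\<phi>. \<bar>f (polar r \<phi>)\<bar> \<le> B"
  shows "norm (fourier_coeff k f r) \<le> B"
proof -
  have "norm (integral {0..2*pi} (\<lambda>\<phi>. complex_of_real (f (polar r \<phi>)) * cis (- (real_of_int k * \<phi>))))
      \<le> B * (2*pi - 0)"
    by (rule integral_bound)
      (use assms in \<open>auto simp: norm_mult intro!: continuous_intros continuous_on_compose2[OF assms(1)]\<close>)
  then show ?thesis
    unfolding fourier_coeff_def by (simp add: norm_mult norm_divide field_simps)
qed

lemma fourier_coeff_const: "fourier_coeff 0 (\<lambda>x. c) r = of_real c"
  by (simp add: fourier_coeff_def scaleR_conv_of_real)

lemma fourier_coeff_diff:
  assumes "continuous_on D f" "continuous_on D g" "\<And>\<phi>. polar r \<phi> \<in> D"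
  shows "fourier_coeff k (\<lambda>x. f x - g x) r = fourier_coeff k f r - fourier_coeff k g r"
  unfolding fourier_coeff_def right_diff_distrib[symmetric]
  using integral_diff[OF fourier_coeff_integrable[OF assms(1,3)] fourier_coeff_integrable[OF assms(2,3)], of k k]
  by (simp add: left_diff_distrib)

lemma fourier_coeff_add:
  assumes "continuous_on D f" "continuous_on D g" "\<And>\<phi>. polar r \<phi> \<in> D"
  shows "fourier_coeff k (\<lambda>x. f x + g x) r = fourier_coeff k f r + fourier_coeff k g r"
  unfolding fourier_coeff_def distrib_left[symmetric]
  using integral_add[OF fourier_coeff_integrable[OF assms(1,3)] fourier_coeff_integrable[OF assms(2,3)], of k k]
  by (simp add: distrib_right)

lemma fourier_coeff_cong:
  assumes "\<And>\<phi>. f (polar r \<phi>) = g (polar r \<phi>)"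
  shows "fourier_coeff k f r = fourier_coeff k g r"
  using assms by (simp add: fourier_coeff_def)

section \<open>Index shifts between polar and Cartesian components\<close>

lemma radial_tangential_polar:
  assumes "r > 0"
  shows "radial_comp v (polar r \<phi>) = cos \<phi> * v (polar r \<phi>) $ 1 + sin \<phi> * v (polar r \<phi>) $ 2"
    and "tangential_comp v (polar r \<phi>) = cos \<phi> * v (polar r \<phi>) $ 2 - sin \<phi> * v (polar r \<phi>) $ 1"
  using assms by (simp_all add: radial_comp_def tangential_comp_def field_simps)

lemma cis_shift:
  "cis (- (of_int (k + 1) * \<phi>)) = cis (- (real_of_int k * \<phi>)) * (of_real (cos \<phi>) - \<i> * of_real (sin \<phi>))"
  "cis (- (of_int (k - 1) * \<phi>)) = cis (- (real_of_int k * \<phi>)) * (of_real (cos \<phi>) + \<i> * of_real (sin \<phi>))"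
proof -
  have "cis (- (of_int (k + 1) * \<phi>)) = cis (- (real_of_int k * \<phi>)) * cis (-\<phi>)"
    "cis (- (of_int (k - 1) * \<phi>)) = cis (- (real_of_int k * \<phi>)) * cis \<phi>"
    by (simp_all add: cis_mult algebra_simps)
  moreover have "cis (-\<phi>) = of_real (cos \<phi>) - \<i> * of_real (sin \<phi>)"
    "cis \<phi> = of_real (cos \<phi>) + \<i> * of_real (sin \<phi>)"
    by (simp_all add: complex_eq_iff)
  ultimately show
    "cis (- (of_int (k + 1) * \<phi>)) = cis (- (real_of_int k * \<phi>)) * (of_real (cos \<phi>) - \<i> * of_real (sin \<phi>))"
    "cis (- (of_int (k - 1) * \<phi>)) = cis (- (real_of_int k * \<phi>)) * (of_real (cos \<phi>) + \<i> * of_real (sin \<phi>))"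
    by simp_all
qed

lemma continuous_on_radial_tangential:
  assumes "continuous_on D (\<lambda>x. v x $ 1)" "continuous_on D (\<lambda>x. v x $ 2)" "0 \<notin> D"
  shows "continuous_on D (radial_comp v)" "continuous_on D (tangential_comp v)"
  using assms unfolding radial_comp_def[abs_def] tangential_comp_def[abs_def]
  by (auto intro!: continuous_intros)

text \<open>Pointwise \<open>v_r + i v_phi = e^(-i phi) (v_1 + i v_2)\<close> and
  \<open>v_r - i v_phi = e^(i phi) (v_1 - i v_2)\<close>; the exponential moves the index by
  one.\<close>

lemma fourier_coeff_radial_tangential:
  assumes "continuous_on D (\<lambda>x. v x $ 1)" "continuous_on D (\<lambda>x. v x $ 2)" "0 \<notin> D" "\<And>\<phi>. polar r \<phi> \<in> D" "r > 0"
  shows "fourier_coeff k (radial_comp v) r + \<i> * fourier_coeff k (tangential_comp v) r =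
      fourier_coeff (k + 1) (\<lambda>x. v x $ 1) r + \<i> * fourier_coeff (k + 1) (\<lambda>x. v x $ 2) r" (is ?A)
    and "fourier_coeff k (radial_comp v) r - \<i> * fourier_coeff k (tangential_comp v) r =
      fourier_coeff (k - 1) (\<lambda>x. v x $ 1) r - \<i> * fourier_coeff (k - 1) (\<lambda>x. v x $ 2) r" (is ?B)
proof -
  note rt = continuous_on_radial_tangential[OF assms(1-3)]
  define I where "I = (\<lambda>k f. (\<lambda>\<phi>. complex_of_real (f (polar r \<phi>)) * cis (- (real_of_int k * \<phi>))))"
  have int: "I k f integrable_on {0..2*pi}" if "continuous_on D f" for f k
    unfolding I_def by (rule fourier_coeff_integrable[OF that assms(4)])
  \<comment> \<open>The common factor \<open>1 / (2 * pi)\<close> is hidden behind \<open>c\<close>,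
    so that the identities can first be proved for the bare integrals.\<close>
  obtain c where fc: "\<And>k f. fourier_coeff k f r = c * integral {0..2*pi} (I k f)"
    unfolding fourier_coeff_def I_def by blast
  have lin: "integral {0..2*pi} (\<lambda>\<phi>. I k f \<phi> + c * I k g \<phi>) = integral {0..2*pi} (I k f) + c * integral {0..2*pi} (I k g)"
    if "continuous_on D f" "continuous_on D g" for k f g c
    by (subst integral_add) (use that int in \<open>auto intro!: integrable_on_mult_right\<close>)
  have scale: "c * x + \<i> * (c * y) = c * z + \<i> * (c * u)" if "x + \<i> * y = z + \<i> * u" for x y z u
    using arg_cong[OF that, of "(*) c"] by (simp add: algebra_simps)
  have scale': "c * x - \<i> * (c * y) = c * z - \<i> * (c * u)" if "x + (-\<i>) * y = z + (-\<i>) * u" for x y z u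
    using arg_cong[OF that, of "(*) c"] by (simp add: algebra_simps)
  have "(\<lambda>\<phi>. I k (radial_comp v) \<phi> + \<i> * I k (tangential_comp v) \<phi>) =
      (\<lambda>\<phi>. I (k + 1) (\<lambda>x. v x $ 1) \<phi> + \<i> * I (k + 1) (\<lambda>x. v x $ 2) \<phi>)"
    unfolding I_def radial_tangential_polar[OF assms(5)] cis_shift by (simp add: fun_eq_iff algebra_simps)
  from arg_cong[OF this, of "integral {0..2*pi}"]
  show ?A unfolding fc lin[OF rt] lin[OF assms(1,2)] by (rule scale)
  have "(\<lambda>\<phi>. I k (radial_comp v) \<phi> + (-\<i>) * I k (tangential_comp v) \<phi>) =
      (\<lambda>\<phi>. I (k - 1) (\<lambda>x. v x $ 1) \<phi> + (-\<i>) * I (k - 1) (\<lambda>x. v x $ 2) \<phi>)"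
    unfolding I_def radial_tangential_polar[OF assms(5)] cis_shift by (simp add: fun_eq_iff algebra_simps)
  from arg_cong[OF this, of "integral {0..2*pi}"]
  show ?B unfolding fc lin[OF rt] lin[OF assms(1,2)]
    by (rule scale')
qed

section \<open>Radial equations for Fourier coefficients\<close>

text \<open>Smoothness is asked on the open exterior only, where \<open>pd\<close> is meaningful;
  values at \<open>r0\<close> are reached separately by continuity.\<close>

definition C1_exterior :: "real \<Rightarrow> (real^2 \<Rightarrow> real) \<Rightarrow> bool" where
  "C1_exterior r0 f \<longleftrightarrow>
     (\<forall>x\<in>exterior_dom r0. f differentiable (at x)) \<and>
     (\<forall>j. continuous_on (exterior_dom r0) (pd j f))"

lemma C1_exteriorD:
  assumes "C1_exterior r0 f"
  shows "x \<in> exterior_dom r0 \<Longrightarrow> f differentiable (at x)"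
    and "continuous_on (exterior_dom r0) (pd j f)"
    and "continuous_on (exterior_dom r0) f"
proof -
  show diff: "f differentiable (at x)" if "x \<in> exterior_dom r0" for x
    using assms that by (auto simp: C1_exterior_def)
  show "continuous_on (exterior_dom r0) f"
    by (intro continuous_at_imp_continuous_on ballI differentiable_imp_continuous_within diff)
qed (use assms in \<open>auto simp: C1_exterior_def\<close>)

lemma zero_notin_exterior [simp]: "0 < r0 \<Longrightarrow> 0 \<notin> exterior_dom r0"
  by (simp add: exterior_dom_def)

lemma continuous_on_grad2_comp:
  assumes "0 < r0" "C1_exterior r0 f"
  shows "continuous_on (exterior_dom r0) (radial_comp (grad2 f))"
    "continuous_on (exterior_dom r0) (tangential_comp (grad2 f))"
  by (rule continuous_on_radial_tangential; use C1_exteriorD(2)[OF assms(2)] assms(1) in simp)+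

text \<open>The angular integral is differentiated under the integral sign over
  \<open>{r0<..}\<close>, which is convex, as the Leibniz rule requires, and open, so that the
  derivative is two-sided.\<close>

lemma has_vector_derivative_fourier_coeff_radial:
  assumes "0 < r0" "C1_exterior r0 f" "r0 < r"
  shows "(fourier_coeff k f has_vector_derivative fourier_coeff k (radial_comp (grad2 f)) r) (at r)"
proof -
  have "((\<lambda>r. integral (cbox 0 (2*pi)) (\<lambda>\<phi>. complex_of_real (f (polar r \<phi>)) * cis (- (real_of_int k * \<phi>))))
    has_vector_derivative integral (cbox 0 (2*pi))
      (\<lambda>\<phi>. complex_of_real (radial_comp (grad2 f) (polar r \<phi>)) * cis (- (real_of_int k * \<phi>)))) (at r within {r0<..})"
  proof (rule leibniz_rule_vector_derivative)
    fix s \<phi> assume "s \<in> {r0<..}" "\<phi> \<in> cbox 0 (2*pi)"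
    then have "((\<lambda>r. f (polar r \<phi>)) has_vector_derivative radial_comp (grad2 f) (polar s \<phi>)) (at s within {r0<..})"
      using assms by (intro has_vector_derivative_at_within[OF has_vector_derivative_polar_radius])
        (auto intro!: C1_exteriorD(1)[OF assms(2)])
    then show "((\<lambda>r. complex_of_real (f (polar r \<phi>)) * cis (- (real_of_int k * \<phi>))) has_vector_derivative
        complex_of_real (radial_comp (grad2 f) (polar s \<phi>)) * cis (- (real_of_int k * \<phi>))) (at s within {r0<..})"
      by (intro has_vector_derivative_mult_left has_vector_derivative_of_real)
        (simp add: has_real_derivative_iff_has_vector_derivative)
  next
    fix s assume "s \<in> {r0<..}"
    then show "(\<lambda>\<phi>. complex_of_real (f (polar s \<phi>)) * cis (- (real_of_int k * \<phi>))) integrable_on cbox 0 (2*pi)"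
      using fourier_coeff_integrable[OF C1_exteriorD(3)[OF assms(2)], of s k] assms(1) by (simp add: cbox_interval)
  next
    have "continuous_on ({r0<..} \<times> cbox 0 (2*pi)) (\<lambda>p. radial_comp (grad2 f) (polar (fst p) (snd p)))"
      by (rule continuous_on_compose2[OF continuous_on_grad2_comp(1)[OF assms(1,2)]])
        (use assms(1) in \<open>auto intro!: continuous_intros\<close>)
    then show "continuous_on ({r0<..} \<times> cbox 0 (2*pi))
      (\<lambda>(s, \<phi>). complex_of_real (radial_comp (grad2 f) (polar s \<phi>)) * cis (- (real_of_int k * \<phi>)))"
      unfolding split_beta by (intro continuous_intros) simp
  qed (use assms in auto)
  then have "((\<lambda>r. integral {0..2*pi} (\<lambda>\<phi>. complex_of_real (f (polar r \<phi>)) * cis (- (real_of_int k * \<phi>))))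
    has_vector_derivative integral {0..2*pi}
      (\<lambda>\<phi>. complex_of_real (radial_comp (grad2 f) (polar r \<phi>)) * cis (- (real_of_int k * \<phi>)))) (at r)"
    using assms(3) by (simp add: cbox_interval at_within_open[of r "{r0<..}"])
  from has_vector_derivative_mult_right[OF this, of "complex_of_real (1 / (2 * pi))"] show ?thesis
    unfolding fourier_coeff_def[abs_def] .
qed

text \<open>Integration by parts in the angle: \<open>f e^(-i k phi)\<close> is periodic, so its
  derivative integrates to zero over a period, and the tangential derivative carries a factor
  \<open>1 / r\<close>.\<close>

lemma fourier_coeff_tangential_grad:
  assumes "0 < r0" "C1_exterior r0 f" "r0 < r"
  shows "fourier_coeff k (tangential_comp (grad2 f)) r = \<i> * of_int k / of_real r * fourier_coeff k f r"
proof -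
  define e where "e = (\<lambda>\<phi>. cis (- (real_of_int k * \<phi>)))"
  define g where "g = (\<lambda>\<phi>. complex_of_real (f (polar r \<phi>)))"
  define h where "h = (\<lambda>\<phi>. complex_of_real (tangential_comp (grad2 f) (polar r \<phi>)))"
  have int: "(\<lambda>\<phi>. g \<phi> * e \<phi>) integrable_on {0..2*pi}" "(\<lambda>\<phi>. h \<phi> * e \<phi>) integrable_on {0..2*pi}"
    unfolding g_def h_def e_def
    by (rule fourier_coeff_integrable[of "exterior_dom r0"];
        use C1_exteriorD(3)[OF assms(2)] continuous_on_grad2_comp[OF assms(1,2)] assms in auto)+
  have deriv: "((\<lambda>\<phi>. g \<phi> * e \<phi>) has_vector_derivative
      (of_real r * (h \<phi> * e \<phi>) - \<i> * of_int k * (g \<phi> * e \<phi>))) (at \<phi> within {0..2*pi})" for \<phi>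
  proof -
    have "((\<lambda>\<phi>. f (polar r \<phi>)) has_vector_derivative r * tangential_comp (grad2 f) (polar r \<phi>)) (at \<phi>)"
      using assms by (intro has_vector_derivative_polar_angle) (auto intro!: C1_exteriorD(1)[OF assms(2)])
    then have "(g has_vector_derivative of_real r * h \<phi>) (at \<phi> within {0..2*pi})"
      unfolding g_def h_def of_real_mult[symmetric]
      by (intro has_vector_derivative_of_real)
        (simp add: has_real_derivative_iff_has_vector_derivative has_vector_derivative_at_within)
    moreover have "(e has_vector_derivative (- \<i> * of_int k * e \<phi>)) (at \<phi> within {0..2*pi})"
      unfolding e_def has_vector_derivative_def
      by (auto intro!: derivative_eq_intros simp: fun_eq_iff scaleR_conv_of_real)
    ultimately show ?thesis
      by (rule has_vector_derivative_eq_rhs[OF has_vector_derivative_mult]) (simp add: algebra_simps)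
  qed
  have ftc: "((\<lambda>\<phi>. of_real r * (h \<phi> * e \<phi>) - \<i> * of_int k * (g \<phi> * e \<phi>)) has_integral
      (g (2*pi) * e (2*pi) - g 0 * e 0)) {0..2*pi}"
    by (rule fundamental_theorem_of_calculus) (use deriv in auto)
  have periodic: "g (2*pi) * e (2*pi) - g 0 * e 0 = 0"
  proof -
    have "cis (- (real_of_int k * (2 * pi))) = 1"
      using cis_multiple_2pi[of "real_of_int (-k)"] by (simp add: algebra_simps)
    then show ?thesis by (simp add: g_def e_def polar_def)
  qed
  have "((\<lambda>\<phi>. of_real r * (h \<phi> * e \<phi>) - \<i> * of_int k * (g \<phi> * e \<phi>)) has_integral
      (of_real r * integral {0..2*pi} (\<lambda>\<phi>. h \<phi> * e \<phi>) - \<i> * of_int k * integral {0..2*pi} (\<lambda>\<phi>. g \<phi> * e \<phi>))) {0..2*pi}"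
    by (intro has_integral_diff has_integral_mult_right integrable_integral int)
  from has_integral_unique[OF this ftc]
  have "of_real r * integral {0..2*pi} (\<lambda>\<phi>. h \<phi> * e \<phi>) = \<i> * of_int k * integral {0..2*pi} (\<lambda>\<phi>. g \<phi> * e \<phi>)"
    unfolding periodic by simp
  then have "integral {0..2*pi} (\<lambda>\<phi>. h \<phi> * e \<phi>) =
      \<i> * of_int k / of_real r * integral {0..2*pi} (\<lambda>\<phi>. g \<phi> * e \<phi>)"
    using assms(1,3) by (simp add: field_simps)
  then show ?thesis
    unfolding fourier_coeff_def h_def g_def e_def by (simp only: mult.left_commute)
qed

text \<open>The radial component of the gradient has coefficient \<open>f_k'\<close>, the tangential
  one \<open>i k f_k / r\<close>. Adding or subtracting \<open>i\<close> times the latter allows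
  either index shift. The second form isolates \<open>f_k' + k f_k / r\<close>, the Robin expression
  for \<open>k >= 0\<close>.\<close>

lemma has_vector_derivative_fourier_coeff:
  assumes "0 < r0" "C1_exterior r0 f" "r0 < r"
  shows "(fourier_coeff k f has_vector_derivative of_int k / of_real r * fourier_coeff k f r +
      (fourier_coeff (k + 1) (pd 1 f) r + \<i> * fourier_coeff (k + 1) (pd 2 f) r)) (at r)" (is ?A)
    and "(fourier_coeff k f has_vector_derivative - (of_int k / of_real r * fourier_coeff k f r) +
      (fourier_coeff (k - 1) (pd 1 f) r - \<i> * fourier_coeff (k - 1) (pd 2 f) r)) (at r)" (is ?B)
proof -
  let ?R = "fourier_coeff k (radial_comp (grad2 f)) r"
  note shift = fourier_coeff_radial_tangential[of "exterior_dom r0" "grad2 f" r k, unfolded grad2_nth,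
      OF C1_exteriorD(2)[OF assms(2)] C1_exteriorD(2)[OF assms(2)]]
  have "?R + \<i> * (\<i> * of_int k / of_real r * fourier_coeff k f r) =
      fourier_coeff (k + 1) (pd 1 f) r + \<i> * fourier_coeff (k + 1) (pd 2 f) r"
    "?R - \<i> * (\<i> * of_int k / of_real r * fourier_coeff k f r) =
      fourier_coeff (k - 1) (pd 1 f) r - \<i> * fourier_coeff (k - 1) (pd 2 f) r"
    using shift assms unfolding fourier_coeff_tangential_grad[OF assms, symmetric] by auto
  then have "?R = of_int k / of_real r * fourier_coeff k f r +
      (fourier_coeff (k + 1) (pd 1 f) r + \<i> * fourier_coeff (k + 1) (pd 2 f) r)"
    "?R = - (of_int k / of_real r * fourier_coeff k f r) +
      (fourier_coeff (k - 1) (pd 1 f) r - \<i> * fourier_coeff (k - 1) (pd 2 f) r)"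
    by (simp_all add: algebra_simps)
  then show ?A ?B
    using has_vector_derivative_fourier_coeff_radial[OF assms, of k] by metis+
qed

text \<open>These are \<open>(d_1 + i d_2) (f - i g) = div - i curl\<close> and
  \<open>(d_1 - i d_2) (f + i g) = div + i curl\<close>, written for coefficients. They serve the
  velocity, where div vanishes and curl is the vorticity, and the gradient of a scalar, where div is
  the Laplacian.\<close>

lemma fourier_coeff_div_curl:
  assumes "0 < r0" "C1_exterior r0 f" "C1_exterior r0 g" "r0 < r"
  shows "((\<lambda>r. fourier_coeff (k - 1) f r - \<i> * fourier_coeff (k - 1) g r) has_vector_derivative
      of_int (k - 1) / of_real r * (fourier_coeff (k - 1) f r - \<i> * fourier_coeff (k - 1) g r) +
      (fourier_coeff k (\<lambda>x. pd 1 f x + pd 2 g x) r - \<i> * fourier_coeff k (\<lambda>x. pd 1 g x - pd 2 f x) r)) (at r)" (is ?A)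
    and "((\<lambda>r. fourier_coeff (k + 1) f r + \<i> * fourier_coeff (k + 1) g r) has_vector_derivative
      - (of_int (k + 1) / of_real r * (fourier_coeff (k + 1) f r + \<i> * fourier_coeff (k + 1) g r)) +
      (fourier_coeff k (\<lambda>x. pd 1 f x + pd 2 g x) r + \<i> * fourier_coeff k (\<lambda>x. pd 1 g x - pd 2 f x) r)) (at r)" (is ?B)
proof -
  note c = C1_exteriorD(2)[OF assms(2)] C1_exteriorD(2)[OF assms(3)]
  have split: "fourier_coeff k (\<lambda>x. pd 1 f x + pd 2 g x) r = fourier_coeff k (pd 1 f) r + fourier_coeff k (pd 2 g) r"
    "fourier_coeff k (\<lambda>x. pd 1 g x - pd 2 f x) r = fourier_coeff k (pd 1 g) r - fourier_coeff k (pd 2 f) r"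
    by (rule fourier_coeff_add fourier_coeff_diff, use c assms in auto)+
  show ?A
    using has_vector_derivative_diff[OF has_vector_derivative_fourier_coeff(1)[OF assms(1,2,4), of "k - 1"]
      has_vector_derivative_mult_right[OF has_vector_derivative_fourier_coeff(1)[OF assms(1,3,4), of "k - 1"], of \<i>]]
    unfolding split by (rule has_vector_derivative_eq_rhs) (simp add: algebra_simps)
  show ?B
    using has_vector_derivative_add[OF has_vector_derivative_fourier_coeff(2)[OF assms(1,2,4), of "k + 1"]
      has_vector_derivative_mult_right[OF has_vector_derivative_fourier_coeff(2)[OF assms(1,3,4), of "k + 1"], of \<i>]]
    unfolding split by (rule has_vector_derivative_eq_rhs) (simp add: algebra_simps)
qed

text \<open>Both forms of the radial derivative of \<open>fourier_coeff k f\<close> are differentiated once more;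
  comparing the results makes the mixed derivatives cancel without Schwarz's theorem.\<close>

lemma fourier_coeff_laplacian:
  assumes "0 < r0" "C1_exterior r0 f" "\<And>j. C1_exterior r0 (pd j f)" "r0 < r"
  shows "((\<lambda>r. fourier_coeff (k - 1) (pd 1 f) r - \<i> * fourier_coeff (k - 1) (pd 2 f) r) has_vector_derivative
      of_int (k - 1) / of_real r * (fourier_coeff (k - 1) (pd 1 f) r - \<i> * fourier_coeff (k - 1) (pd 2 f) r) +
      fourier_coeff k (laplacian2 f) r) (at r)"
proof -
  define P where "P = fourier_coeff k f"
  define U where "U = (\<lambda>r. fourier_coeff (k + 1) (pd 1 f) r + \<i> * fourier_coeff (k + 1) (pd 2 f) r)"
  define V where "V = (\<lambda>r. fourier_coeff (k - 1) (pd 1 f) r - \<i> * fourier_coeff (k - 1) (pd 2 f) r)"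
  define L where "L = fourier_coeff k (\<lambda>x. pd 1 (pd 1 f) x + pd 2 (pd 2 f) x) r"
  \<comment> \<open>\<open>C\<close> measures the commutator of the mixed derivatives, which still
    has to be shown to drop out.\<close>
  define C where "C = \<i> * fourier_coeff k (\<lambda>x. pd 1 (pd 2 f) x - pd 2 (pd 1 f) x) r"
  have P1: "(P has_vector_derivative of_int k / of_real s * P s + U s) (at s)"
    and P2: "(P has_vector_derivative - (of_int k / of_real s * P s) + V s) (at s)" if "r0 < s" for s
    unfolding P_def U_def V_def using has_vector_derivative_fourier_coeff[OF assms(1,2) that] by auto
  have V': "(V has_vector_derivative of_int (k - 1) / of_real r * V r + (L - C)) (at r)"
    and U': "(U has_vector_derivative - (of_int (k + 1) / of_real r * U r) + (L + C)) (at r)"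
    unfolding V_def U_def L_def C_def
    using fourier_coeff_div_curl[OF assms(1) assms(3)[of 1] assms(3)[of 2] assms(4)] by auto
  have VU: "V s = U s + of_int (2 * k) / of_real s * P s" if "r0 < s" for s
    using vector_derivative_unique_at[OF P1[OF that] P2[OF that]] by (simp add: algebra_simps)
  have "((\<lambda>s. of_int (2 * k) * (1 / s)) has_real_derivative (- of_int (2 * k) / r\<^sup>2)) (at r)"
    using assms by (auto intro!: derivative_eq_intros simp: power2_eq_square)
  then have "((\<lambda>s. complex_of_real (of_int (2 * k) * (1 / s))) has_vector_derivative
      complex_of_real (- of_int (2 * k) / r\<^sup>2)) (at r)"
    by (rule has_vector_derivative_of_real)
  then have q: "((\<lambda>s. of_int (2 * k) / complex_of_real s) has_vector_derivative (- of_int (2 * k) / (of_real r)\<^sup>2)) (at r)"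
    by simp
  have "((\<lambda>s. U s + of_int (2 * k) / of_real s * P s) has_vector_derivative
     (- (of_int (k + 1) / of_real r * U r) + (L + C)) +
     (of_int (2 * k) / of_real r * (of_int k / of_real r * P r + U r) +
       (- of_int (2 * k) / (of_real r)\<^sup>2) * P r)) (at r)"
    by (intro has_vector_derivative_add U' has_vector_derivative_mult[OF q] P1 assms(4))
  then have "(V has_vector_derivative
     (- (of_int (k + 1) / of_real r * U r) + (L + C)) +
     (of_int (2 * k) / of_real r * (of_int k / of_real r * P r + U r) +
       (- of_int (2 * k) / (of_real r)\<^sup>2) * P r)) (at r)"
    by (rule has_vector_derivative_transform_within_open[of _ _ _ "{r0<..}"])
      (use assms(4) VU in auto)
  \<comment> \<open>In both expressions for the derivative of \<open>V\<close> the terms in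
    \<open>U\<close>, \<open>P\<close> and \<open>L\<close> agree, which leaves
    \<open>C = - C\<close>.\<close>
  from vector_derivative_unique_at[OF V' this] have "2 * C = 0"
    unfolding VU[OF assms(4)] using assms(1,4) by (simp add: field_simps power2_eq_square)
  then show ?thesis
    using V' unfolding V_def L_def laplacian2_def[abs_def] by simp
qed

text \<open>\<open>r powi m\<close> is the integrating factor for the term \<open>- m V / r\<close>.
  It is used with \<open>m = 1 - k\<close> for the velocity moment and the vorticity flux, and with
  \<open>m = k\<close> for the vorticity coefficient itself.\<close>

lemma has_vector_derivative_weight:
  fixes V :: "real \<Rightarrow> complex"
  assumes "(V has_vector_derivative - (of_int m / of_real r * V r) + W) (at r)" "r > 0"
  shows "((\<lambda>r. of_real (r powi m) * V r) has_vector_derivative of_real (r powi m) * W) (at r)"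
proof -
  have "((\<lambda>r. r powi m) has_real_derivative of_int m * r powi (m - 1)) (at r)"
    using assms(2) by (auto intro!: derivative_eq_intros)
  from has_vector_derivative_mult[OF has_vector_derivative_of_real[OF this] assms(1)]
  show ?thesis
    by (rule has_vector_derivative_eq_rhs)
      (use assms(2) in \<open>simp add: algebra_simps power_int_diff\<close>)
qed

section \<open>Coefficients at infinity and the conserved moment\<close>

lemma Im_fourier_coeff_zero: "Im (fourier_coeff 0 f r) = 0"
  using fourier_coeff_uminus[of 0 f r] by (simp add: complex_eq_iff)

text \<open>Links the zeroth complex coefficient to the real integral by which
  \<open>circulation\<close> is defined.\<close>

lemma Re_fourier_coeff_zero:
  assumes "continuous_on D f" "\<And>\<phi>. polar r \<phi> \<in> D"
  shows "Re (fourier_coeff 0 f r) = integral {0..2*pi} (\<lambda>\<phi>. f (polar r \<phi>)) / (2 * pi)"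
proof -
  have "integral {0..2*pi} (Re \<circ> (\<lambda>\<phi>. complex_of_real (f (polar r \<phi>)) * cis (- (real_of_int 0 * \<phi>)))) =
      Re (integral {0..2*pi} (\<lambda>\<phi>. complex_of_real (f (polar r \<phi>)) * cis (- (real_of_int 0 * \<phi>))))"
    by (rule integral_linear[OF fourier_coeff_integrable[OF assms] bounded_linear_Re])
  then show ?thesis
    by (simp add: fourier_coeff_def o_def)
qed

text \<open>A limit at infinity is uniform in the angle, so the pointwise bound passes to the
  coefficients on each large circle.\<close>

lemma fourier_coeff_tendsto_0:
  assumes "continuous_on D f" "(f \<longlongrightarrow> 0) at_infinity" "\<And>r \<phi>. r \<ge> r0 \<Longrightarrow> polar r \<phi> \<in> D"
  shows "(fourier_coeff k f \<longlongrightarrow> 0) at_top"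
proof (rule tendstoI)
  fix e :: real assume "e > 0"
  \<comment> \<open>Half of \<open>e\<close> leaves room, since the bound on coefficients is not
    strict.\<close>
  then have "eventually (\<lambda>x. dist (f x) 0 < e/2) at_infinity"
    using assms(2) by (intro tendstoD) auto
  then obtain b where b: "\<And>x. b \<le> norm x \<Longrightarrow> \<bar>f x\<bar> < e/2"
    by (auto simp: eventually_at_infinity)
  show "eventually (\<lambda>r. dist (fourier_coeff k f r) 0 < e) at_top"
    using eventually_ge_at_top[of "max r0 (max 0 b)"]
  proof eventually_elim
    case (elim r)
    then have "norm (fourier_coeff k f r) \<le> e/2"
      using b[of "polar r _"] by (intro norm_fourier_coeff_le[OF assms(1)] assms(3)) (auto intro: less_imp_le)
    then show ?case using \<open>e > 0\<close> by simp
  qed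
qed

lemma fourier_coeff_zero_fun [simp]: "fourier_coeff k (\<lambda>x. 0) r = 0"
  by (simp add: fourier_coeff_def)

lemma fourier_coeff_zero_tendsto:
  assumes "continuous_on D f" "(f \<longlongrightarrow> c) at_infinity" "\<And>r \<phi>. r \<ge> r0 \<Longrightarrow> polar r \<phi> \<in> D"
  shows "(fourier_coeff 0 f \<longlongrightarrow> of_real c) at_top"
proof -
  have "(fourier_coeff 0 (\<lambda>x. f x - c) \<longlongrightarrow> 0) at_top"
    by (rule fourier_coeff_tendsto_0[of D _ r0])
      (use assms in \<open>auto intro!: continuous_intros tendsto_eq_intros\<close>)
  then have "((\<lambda>r. fourier_coeff 0 (\<lambda>x. f x - c) r + of_real c) \<longlongrightarrow> 0 + of_real c) at_top"
    by (intro tendsto_intros)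
  then show ?thesis
  proof (rule Lim_transform_eventually[OF tendsto_eq_rhs])
    show "eventually (\<lambda>r. fourier_coeff 0 (\<lambda>x. f x - c) r + of_real c = fourier_coeff 0 f r) at_top"
      using eventually_ge_at_top[of r0]
      by eventually_elim (subst fourier_coeff_diff[of D], use assms in \<open>auto simp: fourier_coeff_const\<close>)
  qed simp
qed

text \<open>\<open>N r\<close> is the integral of \<open>s powi (1 - k) * fourier_coeff k \<omega> s\<close> over \<open>s\<close> between \<open>r0\<close> and \<open>r\<close>.
  For \<open>k = 0\<close> its limit is the circulation at infinity, for \<open>k = 1\<close> it is the velocity at infinity.\<close>

lemma no_slip_moment:
  assumes "0 < r0" "0 \<le> k" "curl_inverse r0 vinf \<omega> v" "vanishes_on_circle r0 v"
  defines "N \<equiv> \<lambda>r. complex_of_real (r powi (1 - k)) *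
    (\<i> * (fourier_coeff (k - 1) (\<lambda>x. v x $ 1) r - \<i> * fourier_coeff (k - 1) (\<lambda>x. v x $ 2) r))"
  shows "continuous_on {r0..} N" "N r0 = 0"
    "\<And>r. r0 < r \<Longrightarrow> (N has_vector_derivative of_real (r powi (1 - k)) * fourier_coeff k \<omega> r) (at r)"
    "(N \<longlongrightarrow> (if k = 1 then \<i> * of_real vinf else 0)) at_top"
proof -
  let ?v1 = "\<lambda>x. v x $ 1" and ?v2 = "\<lambda>x. v x $ 2"
  have flow: "continuous_on (closed_exterior r0) v" "\<And>x. x \<in> exterior_dom r0 \<Longrightarrow> v differentiable (at x)"
    "\<And>x. x \<in> exterior_dom r0 \<Longrightarrow> div2 v x = 0" "(v \<longlongrightarrow> vector [vinf, 0]) at_infinity"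
    "(circulation v \<longlongrightarrow> 0) at_top"
    and curl: "\<And>x. x \<in> exterior_dom r0 \<Longrightarrow> curl2 v x = \<omega> x"
    and pd: "\<And>i j. continuous_on (exterior_dom r0) (pd j (\<lambda>x. v x $ i))"
    using assms(3) by (auto simp: curl_inverse_def exterior_flow_def)
  have C1: "C1_exterior r0 (\<lambda>x. v x $ i)" for i
    unfolding C1_exterior_def using pd flow(2)
    unfolding differentiable_def
    by (blast intro: bounded_linear.has_derivative[OF bounded_linear_vec_nth])
  have cont: "continuous_on (closed_exterior r0) (\<lambda>x. v x $ i)" for i
    by (intro continuous_intros flow)
  have contfc: "continuous_on {r0..} (fourier_coeff m (\<lambda>x. v x $ i))" for m i
    by (rule continuous_on_fourier_coeff[OF cont]) (use assms(1) in auto)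
  show contN: "continuous_on {r0..} N"
    unfolding N_def by (intro continuous_intros contfc) (use assms(1) in auto)
  \<comment> \<open>No-slip enters here: on the circle the velocity coefficients are those of the
    zero function.\<close>
  have "fourier_coeff m (\<lambda>x. v x $ i) r0 = fourier_coeff m (\<lambda>x. 0) r0" for m i
    by (rule fourier_coeff_cong) (use assms(1,4) in \<open>simp add: vanishes_on_circle_def\<close>)
  then show N0: "N r0 = 0"
    by (simp add: N_def)
  show N': "(N has_vector_derivative of_real (r powi (1 - k)) * fourier_coeff k \<omega> r) (at r)" if "r0 < r" for r
  proof -
    have "fourier_coeff k (\<lambda>x. pd 1 ?v1 x + pd 2 ?v2 x) r = fourier_coeff k (\<lambda>x. 0) r"
      "fourier_coeff k (\<lambda>x. pd 1 ?v2 x - pd 2 ?v1 x) r = fourier_coeff k \<omega> r"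
      by (rule fourier_coeff_cong; use assms(1) that flow(3) curl in \<open>simp add: div2_def curl2_def\<close>)+
    \<comment> \<open>As \<open>div v = 0\<close>, only \<open>- i\<close> times the vorticity
      coefficient remains; the factor \<open>i\<close> in \<open>N\<close> turns it into the
      coefficient itself, and the weight absorbs the \<open>(k - 1) / r\<close> term.\<close>
    then have "((\<lambda>r. \<i> * (fourier_coeff (k - 1) ?v1 r - \<i> * fourier_coeff (k - 1) ?v2 r)) has_vector_derivative
      \<i> * (of_int (k - 1) / of_real r * (fourier_coeff (k - 1) ?v1 r - \<i> * fourier_coeff (k - 1) ?v2 r) -
        \<i> * fourier_coeff k \<omega> r)) (at r)"
      using has_vector_derivative_mult_right[OF fourier_coeff_div_curl(1)[OF assms(1) C1[of 1] C1[of 2] that, of k], of \<i>]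
      by simp
    then show ?thesis
      unfolding N_def
      by (intro has_vector_derivative_weight, elim has_vector_derivative_eq_rhs)
        (use that assms(1) in \<open>auto simp: divide_simps, simp add: algebra_simps\<close>)
  qed
  have lim: "((\<lambda>x. v x $ 1) \<longlongrightarrow> vinf) at_infinity" "((\<lambda>x. v x $ 2) \<longlongrightarrow> 0) at_infinity"
    using tendsto_vec_nth[OF flow(4), of 1] tendsto_vec_nth[OF flow(4), of 2] by simp_all
  \<comment> \<open>The weight \<open>r powi (1 - k)\<close> is \<open>1\<close> for
    \<open>k = 1\<close>, where the mean velocity has the prescribed limit; it decays at least like
    \<open>1 / r\<close> for \<open>k >= 2\<close>, where a bounded velocity suffices; it is
    \<open>r\<close> for \<open>k = 0\<close>, where the circulation controls
    \<open>N\<close>.\<close>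
  consider "k = 0" | "k = 1" | "k \<ge> 2" using assms(2) by linarith
  then show "(N \<longlongrightarrow> (if k = 1 then \<i> * of_real vinf else 0)) at_top"
  proof cases
    assume k: "k = 1"
    have "((\<lambda>r. \<i> * (fourier_coeff 0 ?v1 r - \<i> * fourier_coeff 0 ?v2 r)) \<longlongrightarrow>
        \<i> * (of_real vinf - \<i> * of_real 0)) at_top"
      by (intro tendsto_intros fourier_coeff_zero_tendsto[OF cont, of _ _ r0] lim) (use assms(1) in auto)
    then show ?thesis by (simp add: N_def k)
  next
    assume k: "k \<ge> 2"
    have "eventually (\<lambda>x. dist (v x) (vector [vinf, 0]) < 1) at_infinity"
      by (rule tendstoD[OF flow(4)]) simp
    then obtain b where b: "\<And>x. b \<le> norm x \<Longrightarrow> dist (v x) (vector [vinf, 0]) < 1"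
      by (auto simp: eventually_at_infinity)
    define B where "B = norm (vector [vinf, 0] :: real^2) + 1"
    have B: "\<bar>v x $ i\<bar> \<le> B" if "b \<le> norm x" for x i
      using b[OF that] component_le_norm_cart[of "v x" i] norm_triangle_sub[of "v x" "vector [vinf, 0]"]
      unfolding B_def dist_norm by linarith
    have "((\<lambda>r. 2 * B * inverse r) \<longlongrightarrow> 2 * B * 0) at_top"
      by (intro tendsto_intros tendsto_inverse_0_at_top filterlim_ident)
    then have lim0: "((\<lambda>r. 2 * B * inverse r) \<longlongrightarrow> 0) at_top"
      by simp
    have "eventually (\<lambda>r. norm (N r) \<le> 2 * B * inverse r) at_top"
      using eventually_ge_at_top[of "max r0 (max 1 b)"]
    proof eventually_elim
      case (elim r)
      have fcB: "norm (fourier_coeff m (\<lambda>x. v x $ i) r) \<le> B" for m i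
        by (rule norm_fourier_coeff_le[OF cont]) (use elim assms(1) in \<open>auto intro!: B\<close>)
      have "norm (fourier_coeff (k - 1) ?v1 r - \<i> * fourier_coeff (k - 1) ?v2 r) \<le> 2 * B"
        using fcB[of "k-1" 1] fcB[of "k-1" 2]
          norm_triangle_ineq4[of "fourier_coeff (k - 1) ?v1 r" "\<i> * fourier_coeff (k - 1) ?v2 r"]
        by (simp add: norm_mult)
      moreover have "\<bar>r powi (1 - k)\<bar> \<le> inverse r"
        using power_int_increasing[of "1 - k" "-1" r] elim k by (simp add: power_int_minus)
      ultimately have "\<bar>r powi (1 - k)\<bar> *
          norm (fourier_coeff (k - 1) ?v1 r - \<i> * fourier_coeff (k - 1) ?v2 r) \<le> inverse r * (2 * B)"
        using elim by (intro mult_mono) auto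
      then show ?case
        unfolding N_def norm_mult norm_of_real norm_ii by (simp add: mult.commute)
    qed
    then have "(N \<longlongrightarrow> 0) at_top"
      by (rule Lim_null_comparison[OF _ lim0])
    then show ?thesis using k by simp
  next
    assume k: "k = 0"
    \<comment> \<open>For \<open>k = 0\<close> the imaginary part of \<open>N\<close> is
      \<open>r\<close> times the mean radial velocity, the flux through the circle up to
      \<open>2 * pi\<close>. It is constant because the zeroth vorticity coefficient is
      real.\<close>
    have Im: "Im (N r) = 0" if "r0 \<le> r" for r
    proof (cases "r = r0")
      case False
      have "Im (N r) = Im (N r0)"
      proof (rule DERIV_isconst_end[where f = "\<lambda>r. Im (N r)" and a = r0 and b = r])
        show "continuous_on {r0..r} (\<lambda>r. Im (N r))"
          by (intro continuous_intros continuous_on_subset[OF contN]) auto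
        fix s assume "r0 < s" "s < r"
        then have "((\<lambda>r. Im (N r)) has_vector_derivative Im (of_real (s powi (1 - k)) * fourier_coeff k \<omega> s)) (at s)"
          by (intro bounded_linear.has_vector_derivative[OF bounded_linear_Im] N')
        then show "DERIV (\<lambda>r. Im (N r)) s :> 0"
          by (simp add: has_real_derivative_iff_has_vector_derivative k Im_fourier_coeff_zero)
      qed (use that False in auto)
      then show ?thesis by (simp add: N0)
    qed (simp add: N0)
    have N: "N r = of_real (circulation v r / (2 * pi))" if "r0 \<le> r" for r
    proof -
      have D: "0 \<notin> closed_exterior r0" "\<And>\<phi>. polar r \<phi> \<in> closed_exterior r0"
        using assms(1) that by (auto simp: closed_exterior_def)
      have "N r = of_real r * (\<i> * (fourier_coeff 0 (radial_comp v) r - \<i> * fourier_coeff 0 (tangential_comp v) r))"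
        using fourier_coeff_radial_tangential(2)[OF cont cont D, of 0] assms(1) that
        by (simp add: N_def k)
      then have "Re (N r) = r * Re (fourier_coeff 0 (tangential_comp v) r)"
        by (simp add: Im_fourier_coeff_zero)
      also have "\<dots> = circulation v r / (2 * pi)"
        by (subst Re_fourier_coeff_zero[OF continuous_on_radial_tangential(2)[OF cont cont D(1)] D(2)])
          (simp add: circulation_def mult.commute)
      finally show ?thesis using Im[OF that] by (simp add: complex_eq_iff)
    qed
    have "((\<lambda>r. complex_of_real (circulation v r / (2 * pi))) \<longlongrightarrow> of_real (0 / (2 * pi))) at_top"
      by (intro tendsto_intros flow) simp
    moreover have "eventually (\<lambda>r. complex_of_real (circulation v r / (2 * pi)) = N r) at_top"
      using eventually_ge_at_top[of r0] by eventually_elim (rule N[symmetric])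
    ultimately have "(N \<longlongrightarrow> of_real (0 / (2 * pi))) at_top"
      by (rule Lim_transform_eventually)
    then show ?thesis using k by simp
  qed
qed

section \<open>Logarithmic growth and a Baire argument on intervals\<close>

text \<open>Beyond some radius \<open>x' >= q / r\<close>: for \<open>k = 0\<close> the equation
  reads \<open>x' = y / r\<close>, and for \<open>k >= 1\<close> the forcing is at least
  \<open>q\<close> while the damping is at most \<open>k M / r\<close>. So \<open>x\<close> grows at
  least like \<open>q ln r\<close>, against its bound.\<close>

lemma bounded_solution_log_growth:
  fixes x y :: "real \<Rightarrow> real" and k :: int
  assumes "0 \<le> k" "0 < q"
    and deriv: "\<And>r. R < r \<Longrightarrow> (x has_real_derivative - (of_int k / r * x r) + r powi (k - 1) * y r) (at r)"
    and y: "\<And>r. R < r \<Longrightarrow> q \<le> y r" and x: "\<And>r. R < r \<Longrightarrow> \<bar>x r\<bar> \<le> M"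
  shows False
proof -
  \<comment> \<open>The last entry ensures \<open>k M + q <= q r\<close>, hence
    \<open>q / r <= q - k M / r\<close>, for \<open>r >= S\<close>; the others keep \<open>r\<close>
    beyond \<open>R\<close> and, for \<open>k >= 1\<close>, \<open>r powi (k - 1)\<close> at least
    \<open>1\<close>.\<close>
  define S where "S = max (R + 1) (max 1 ((of_int k * M + q) / q))"
  have S: "S > R" "S \<ge> 1" "S \<ge> (of_int k * M + q) / q" by (auto simp: S_def)
  have M: "0 \<le> M" using x[of "R + 1"] by auto
  have growth: "q / r \<le> - (of_int k / r * x r) + r powi (k - 1) * y r" if "S \<le> r" for r
  proof (cases "k = 0")
    case True
    then show ?thesis
      using y[of r] S that by (simp add: power_int_minus divide_simps)
  next
    case False
    have r: "R < r" "1 \<le> r" "of_int k * M + q \<le> q * r"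
      using S that assms(2) by (auto simp: field_simps intro: order_trans)
    have "q \<le> r powi (k - 1) * y r"
      using mult_mono[of 1 "r powi (k - 1)" q "y r"] one_le_power_int[of r "k - 1"] y[of r] r False assms(1,2) by auto
    moreover have "of_int k / r * x r \<le> of_int k / r * M"
      using x[of r] r assms(1) by (intro mult_left_mono) auto
    moreover have "q / r \<le> q - of_int k / r * M"
      using r by (simp add: field_simps)
    ultimately show ?thesis by linarith
  qed
  \<comment> \<open>\<open>q ln T\<close> exceeds \<open>q ln S\<close> by \<open>2 M + 1\<close>,
    more than \<open>x\<close> can vary between \<open>- M\<close> and \<open>M\<close>.\<close>
  define T where "T = S * exp ((2 * M + 1) / q)"
  have T: "S \<le> T" using S M assms(2) by (simp add: T_def)
  have "x S - q * ln S \<le> x T - q * ln T"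
  proof (rule DERIV_nonneg_imp_nondecreasing[OF T])
    fix r assume r: "S \<le> r" "r \<le> T"
    have "((\<lambda>r. x r - q * ln r) has_real_derivative (- (of_int k / r * x r) + r powi (k - 1) * y r) - q * (1 / r)) (at r)"
      using r S by (auto intro!: derivative_eq_intros deriv)
    then show "\<exists>z. ((\<lambda>r. x r - q * ln r) has_real_derivative z) (at r) \<and> 0 \<le> z"
      using growth[OF r(1)] by auto
  qed
  moreover have "q * ln T = q * ln S + (2 * M + 1)"
    using S assms(2) by (simp add: T_def ln_mult distrib_left) (simp add: field_simps)
  ultimately show False
    using x[of S] x[of T] S T by auto
qed

text \<open>If no \<open>E n\<close> contained a nondegenerate interval, the complements in
  \<open>{a..b}\<close> would be relatively open and dense, and their intersection, which is empty,
  would be dense by Baire's theorem.\<close>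

lemma Baire_interval:
  fixes E :: "nat \<Rightarrow> real set"
  assumes "a < b" "\<And>n. closed (E n)" "{a..b} \<subseteq> (\<Union>n. E n)"
  obtains n c d where "a \<le> c" "c < d" "d \<le> b" "{c..d} \<subseteq> E n"
proof -
  have "\<exists>n c d. a \<le> c \<and> c < d \<and> d \<le> b \<and> {c..d} \<subseteq> E n"
  proof (rule ccontr)
    assume no: "\<not> ?thesis"
    have "{a..b} \<subseteq> closure (\<Inter>(range (\<lambda>n. {a..b} - E n)))"
    proof (rule Baire)
      fix T assume "T \<in> range (\<lambda>n. {a..b} - E n)"
      then obtain n where T: "T = {a..b} - E n" by auto
      have "x \<in> closure T" if x: "x \<in> {a..b}" for x
        unfolding closure_approachable
      proof (intro allI impI)
        fix e :: real assume "e > 0"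
        \<comment> \<open>Clipping to \<open>{a..b}\<close> keeps the interval nondegenerate even
          when \<open>x\<close> is an endpoint.\<close>
        define c d where "c = max a (x - e/2)" and "d = min b (x + e/2)"
        have "a \<le> c" "c < d" "d \<le> b" using x \<open>e > 0\<close> \<open>a < b\<close> by (auto simp: c_def d_def)
        then obtain y where "y \<in> {c..d}" "y \<notin> E n" using no by blast
        then have "y \<in> T" "dist y x < e"
          using x \<open>e > 0\<close> by (auto simp: T c_def d_def dist_real_def)
        then show "\<exists>y\<in>T. dist y x < e" by blast
      qed
      moreover have "openin (top_of_set {a..b}) T"
        unfolding T openin_open using assms(2)[of n] by (auto intro!: exI[of _ "- E n"])
      ultimately show "openin (top_of_set {a..b}) T \<and> {a..b} \<subseteq> closure T" by auto
    qed auto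
    moreover have "\<Inter>(range (\<lambda>n. {a..b} - E n)) = {}" using assms(3) by auto
    ultimately show False using \<open>a < b\<close> unfolding \<open>_ = {}\<close> by simp
  qed
  then show thesis using that by blast
qed

section \<open>One-sided derivatives, time integrals and the mean flux\<close>

text \<open>By the fundamental theorem \<open>f x\<close> is \<open>f a\<close> plus the integral of
  \<open>f'\<close>, and continuity of \<open>f'\<close> at \<open>a\<close> differentiates this
  integral from the right. It transfers an interior radial equation to the circle.\<close>

lemma has_vector_derivative_boundary:
  fixes f f' :: "real \<Rightarrow> 'a::banach"
  assumes "continuous_on {a..} f" "continuous_on {a..} f'"
    "\<And>x. a < x \<Longrightarrow> (f has_vector_derivative f' x) (at x)"
  shows "(f has_vector_derivative f' a) (at a within {a..})"
proof -
  have ftc: "f a + integral {a..x} f' = f x" if "a \<le> x" for x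
  proof -
    have "(f' has_integral (f x - f a)) {a..x}"
      by (rule fundamental_theorem_of_calculus_interior)
        (use that assms in \<open>auto intro: continuous_on_subset\<close>)
    then show ?thesis by (simp add: integral_unique)
  qed
  have "((\<lambda>x. integral {a..x} f') has_vector_derivative f' a) (at a within {a..a+1})"
    by (rule integral_has_vector_derivative) (auto intro: continuous_on_subset[OF assms(2)])
  then have "((\<lambda>x. f a + integral {a..x} f') has_vector_derivative 0 + f' a) (at a within {a..a+1})"
    by (intro has_vector_derivative_add) auto
  then have "(f has_vector_derivative f' a) (at a within {a..a+1})"
    by (rule has_vector_derivative_transform[rotated 2, OF has_vector_derivative_eq_rhs]) (use ftc in auto)
  moreover have "at a within {a..a+1} = at a within {a..}"
    by (rule at_within_nhd[of _ "{a-1<..<a+1}"]) auto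
  ultimately show ?thesis by simp
qed

lemma continuous_on_integral_slice:
  fixes G :: "real \<Rightarrow> real \<Rightarrow> complex"
  assumes "continuous_on (T \<times> S) (\<lambda>(t, r). G t r)" "{c..d} \<subseteq> T"
  shows "continuous_on S (\<lambda>r. integral {c..d} (\<lambda>t. G t r))"
proof -
  have "continuous_on (S \<times> cbox c d) (\<lambda>p. (\<lambda>(t, r). G t r) (snd p, fst p))"
    by (rule continuous_on_compose2[OF assms(1)]) (use assms(2) in \<open>auto intro!: continuous_intros\<close>)
  then have "continuous_on (S \<times> cbox c d) (\<lambda>(r, t). G t r)"
    by (simp add: split_beta)
  from integral_continuous_on_param[OF this] show ?thesis
    by (simp add: cbox_interval)
qed

lemma continuous_on_time_slice:
  fixes G :: "real \<Rightarrow> real \<Rightarrow> complex"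
  assumes "continuous_on (T \<times> S) (\<lambda>(t, r). G t r)" "r \<in> S" "A \<subseteq> T"
  shows "continuous_on A (\<lambda>t. G t r)"
proof -
  have "continuous_on A (\<lambda>t. (\<lambda>(t, r). G t r) (t, r))"
    by (rule continuous_on_compose2[OF assms(1)]) (use assms in \<open>auto intro!: continuous_intros\<close>)
  then show ?thesis by simp
qed

lemma has_vector_derivative_integral_slice:
  fixes G G' :: "real \<Rightarrow> real \<Rightarrow> complex"
  assumes "continuous_on (T \<times> {r0<..}) (\<lambda>(t, r). G t r)" "continuous_on (T \<times> {r0<..}) (\<lambda>(t, r). G' t r)"
    "\<And>t r. t \<in> T \<Longrightarrow> r0 < r \<Longrightarrow> (G t has_vector_derivative G' t r) (at r)" "{c..d} \<subseteq> T" "r0 < r"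
  shows "((\<lambda>r. integral {c..d} (\<lambda>t. G t r)) has_vector_derivative integral {c..d} (\<lambda>t. G' t r)) (at r)"
proof -
  have "((\<lambda>r. integral (cbox c d) (\<lambda>t. G t r)) has_vector_derivative integral (cbox c d) (\<lambda>t. G' t r)) (at r within {r0<..})"
  proof (rule leibniz_rule_vector_derivative)
    show "((\<lambda>x. G t x) has_vector_derivative G' t x) (at x within {r0<..})"
      if "x \<in> {r0<..}" "t \<in> cbox c d" for x t
      by (rule has_vector_derivative_at_within, rule assms(3)) (use assms(4) that in auto)
    show "(\<lambda>t. G t x) integrable_on cbox c d" if "x \<in> {r0<..}" for x
      unfolding cbox_interval
      by (rule integrable_continuous_real, rule continuous_on_time_slice[OF assms(1) that assms(4)])
    have "continuous_on ({r0<..} \<times> cbox c d) (\<lambda>p. (\<lambda>(t, r). G' t r) (snd p, fst p))"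
      by (rule continuous_on_compose2[OF assms(2)]) (use assms(4) in \<open>auto intro!: continuous_intros\<close>)
    then show "continuous_on ({r0<..} \<times> cbox c d) (\<lambda>(x, t). G' t x)"
      by (simp add: split_beta)
  qed (use assms in auto)
  then show ?thesis
    using assms(5) by (simp add: cbox_interval at_within_open[of r "{r0<..}"])
qed

text \<open>Let \<open>P\<close> solve the radial heat equation, with \<open>V = P\<^sub>r + k P / r\<close>. The conserved moment makes the
  time integral of the weighted flux \<open>r\<^sup>1\<^sup>-\<^sup>k V\<close> at radius \<open>r\<close> converge, as \<open>r\<close> grows, to its value
  at \<open>r0\<close>. A nonzero limit would force the time integral of \<open>P\<close> to grow at least
  logarithmically.\<close>

lemma zero_mean_flux:
  fixes P P' V N :: "real \<Rightarrow> real \<Rightarrow> complex" and k :: int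
  assumes "0 < r0" "0 \<le> k" "0 < c" "c < d"
    and contP: "continuous_on ({0<..} \<times> {r0<..}) (\<lambda>(t, r). P t r)"
    and contP': "continuous_on ({0<..} \<times> {r0<..}) (\<lambda>(t, r). P' t r)"
    and contV: "continuous_on ({0<..} \<times> {r0..}) (\<lambda>(t, r). V t r)"
    and dPt: "\<And>t r. 0 < t \<Longrightarrow> r0 < r \<Longrightarrow> ((\<lambda>t. P t r) has_vector_derivative P' t r) (at t)"
    and dPr: "\<And>t r. 0 < t \<Longrightarrow> r0 < r \<Longrightarrow>
      (P t has_vector_derivative - (of_int k / of_real r * P t r) + V t r) (at r)"
    and dV: "\<And>t r. 0 < t \<Longrightarrow> r0 < r \<Longrightarrow>
      (V t has_vector_derivative of_int (k - 1) / of_real r * V t r + P' t r) (at r)"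
    and contN: "\<And>t. 0 < t \<Longrightarrow> continuous_on {r0..} (N t)"
    and N0: "\<And>t. 0 < t \<Longrightarrow> N t r0 = 0"
    and dN: "\<And>t r. 0 < t \<Longrightarrow> r0 < r \<Longrightarrow>
      (N t has_vector_derivative of_real (r powi (1 - k)) * P t r) (at r)"
    and limN: "\<And>t. 0 < t \<Longrightarrow> (N t \<longlongrightarrow> L) at_top"
    and bound: "\<And>t r. t \<in> {c..d} \<Longrightarrow> R < r \<Longrightarrow> norm (P t r) \<le> B"
  shows "integral {c..d} (\<lambda>t. V t r0) = 0"
proof (rule ccontr)
  assume nz: "integral {c..d} (\<lambda>t. V t r0) \<noteq> 0"
  have cd: "{c..d} \<subseteq> {0<..}" using assms(3) by auto
  define F where "F = (\<lambda>t r. of_real (r powi (1 - k)) * V t r)"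
  define H where "H = (\<lambda>r. integral {c..d} (\<lambda>t. F t r))"
  define X where "X = (\<lambda>r. integral {c..d} (\<lambda>t. P t r))"
  have powi_cont: "continuous_on S (\<lambda>p. complex_of_real (snd p powi m))"
    if "S \<subseteq> UNIV \<times> {r0..}" for S :: "(real \<times> real) set" and m
    using that assms(1) by (intro continuous_intros) auto
  have contF: "continuous_on ({0<..} \<times> {r0..}) (\<lambda>(t, r). F t r)"
    using contV unfolding F_def split_beta by (intro continuous_on_mult powi_cont) auto
  have contV': "continuous_on ({0<..} \<times> {r0<..}) (\<lambda>(t, r). V t r)"
    and contF': "continuous_on ({0<..} \<times> {r0<..}) (\<lambda>(t, r). F t r)"
    by (rule continuous_on_subset[OF contV] continuous_on_subset[OF contF], force)+
  have dF: "(F t has_vector_derivative of_real (r powi (1 - k)) * P' t r) (at r)" if "0 < t" "r0 < r" for t r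
    unfolding F_def
    by (intro has_vector_derivative_weight has_vector_derivative_eq_rhs[OF dV[OF that]])
      (use assms(1) that in \<open>auto simp: diff_divide_distrib algebra_simps\<close>)
  \<comment> \<open>Integrating \<open>P'\<close> over time leaves the values at \<open>c\<close>
    and \<open>d\<close>, so \<open>H\<close> has the same radial derivative as
    \<open>N d - N c\<close>.\<close>
  have dH: "(H has_vector_derivative of_real (r powi (1 - k)) * (P d r - P c r)) (at r)" if "r0 < r" for r
  proof -
    have "((\<lambda>t. P' t r) has_integral (P d r - P c r)) {c..d}"
      by (rule fundamental_theorem_of_calculus)
        (use assms that dPt in \<open>auto intro: has_vector_derivative_at_within\<close>)
    then have "integral {c..d} (\<lambda>t. of_real (r powi (1 - k)) * P' t r) = of_real (r powi (1 - k)) * (P d r - P c r)"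
      by (simp add: integral_unique)
    moreover have "continuous_on ({0<..} \<times> {r0<..}) (\<lambda>(t, r). complex_of_real (r powi (1 - k)) * P' t r)"
      using contP' unfolding split_beta by (intro continuous_on_mult powi_cont) auto
    ultimately show ?thesis
      using has_vector_derivative_integral_slice[OF contF' _ _ cd that] dF unfolding H_def by fastforce
  qed
  have H: "H r = H r0 + (N d r - N c r)" if "r0 \<le> r" for r
  proof -
    have contH: "continuous_on {r0..} H"
      unfolding H_def by (rule continuous_on_integral_slice[OF contF cd])
    have "((\<lambda>x. 0) has_integral ((H r - (N d r - N c r)) - (H r0 - (N d r0 - N c r0)))) {r0..r}"
    proof (rule fundamental_theorem_of_calculus_interior[OF that])
      show "continuous_on {r0..r} (\<lambda>r. H r - (N d r - N c r))"
        by (intro continuous_intros continuous_on_subset[OF contH] continuous_on_subset[OF contN])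
          (use assms in auto)
      show "((\<lambda>r. H r - (N d r - N c r)) has_vector_derivative 0) (at x)" if "x \<in> {r0<..<r}" for x
        using has_vector_derivative_diff[OF dH has_vector_derivative_diff[OF dN[of d] dN[of c]], of x] that assms
        by (simp add: algebra_simps)
    qed
    then have "H r - (N d r - N c r) = H r0 - (N d r0 - N c r0)"
      using has_integral_0_eq by fastforce
    then show ?thesis using N0 assms(3,4) by (simp add: algebra_simps)
  qed
  \<comment> \<open>Both moments have the same limit \<open>L\<close>, so their contributions cancel
    as \<open>r\<close> grows.\<close>
  have "((\<lambda>r. H r0 + (N d r - N c r)) \<longlongrightarrow> H r0 + (L - L)) at_top"
    using assms(3,4) by (intro tendsto_intros limN) auto
  moreover have "eventually (\<lambda>r. H r0 + (N d r - N c r) = H r) at_top"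
    using eventually_ge_at_top[of r0] by eventually_elim (rule H[symmetric])
  ultimately have "(H \<longlongrightarrow> H r0 + (L - L)) at_top"
    by (rule Lim_transform_eventually)
  then have limH: "(H \<longlongrightarrow> H r0) at_top" by simp
  have H0: "H r0 \<noteq> 0"
    using nz assms(1) by (simp add: H_def F_def)
  have dX: "(X has_vector_derivative - (of_int k / of_real r * X r) + of_real (r powi (k - 1)) * H r) (at r)"
    if "r0 < r" for r
  proof -
    have r: "r \<noteq> 0" using that assms(1) by auto
    have PF: "- (of_int k / of_real r * P t r) + V t r =
        - (of_int k / of_real r * P t r) + of_real (r powi (k - 1)) * F t r" for t
      using r by (simp add: F_def power_int_diff)
    have "continuous_on ({0<..} \<times> {r0<..}) (\<lambda>(t, r). - (of_int k / of_real r * P t r) + V t r)"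
      using contP contV' assms(1) unfolding split_beta by (intro continuous_intros) auto
    from has_vector_derivative_integral_slice[OF contP this _ cd that] dPr
    have "(X has_vector_derivative integral {c..d} (\<lambda>t. - (of_int k / of_real r * P t r) + V t r)) (at r)"
      unfolding X_def by auto
    also have "(\<lambda>t. - (of_int k / of_real r * P t r) + V t r) =
        (\<lambda>t. (- (of_int k / of_real r)) * P t r + of_real (r powi (k - 1)) * F t r)"
      unfolding PF by simp
    also have "integral {c..d} \<dots> = (- (of_int k / of_real r)) * X r + of_real (r powi (k - 1)) * H r"
      unfolding X_def H_def
      using continuous_on_time_slice[OF contP _ cd, of r] continuous_on_time_slice[OF contF' _ cd, of r] that r
      by (subst integral_add) (auto intro!: integrable_continuous_real continuous_intros)
    finally show ?thesis by simp
  qed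
  \<comment> \<open>Multiplying by \<open>cnj (H r0)\<close> and taking real parts projects the
    complex equation onto the direction of \<open>H r0\<close>. There the factor \<open>H r\<close>
    tends to the squared norm of \<open>H r0\<close>, so half of that is an eventual lower
    bound.\<close>
  define q where "q = (norm (H r0))\<^sup>2 / 2"
  have "((\<lambda>r. Re (cnj (H r0) * H r)) \<longlongrightarrow> Re (cnj (H r0) * H r0)) at_top"
    by (intro tendsto_intros limH)
  moreover have "Re (cnj (H r0) * H r0) = (norm (H r0))\<^sup>2"
    unfolding cmod_power2 by (simp add: power2_eq_square)
  ultimately have "((\<lambda>r. Re (cnj (H r0) * H r)) \<longlongrightarrow> (norm (H r0))\<^sup>2) at_top" by simp
  moreover have "q < (norm (H r0))\<^sup>2" using H0 by (simp add: q_def)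
  ultimately have "eventually (\<lambda>r. q < Re (cnj (H r0) * H r)) at_top"
    by (rule order_tendstoD)
  then obtain R1 where R1: "\<And>r. R1 \<le> r \<Longrightarrow> q < Re (cnj (H r0) * H r)"
    by (auto simp: eventually_at_top_linorder)
  have X_bound: "norm (X r) \<le> B * (d - c)" if "R < r" "r0 < r" for r
    unfolding X_def using assms(4) bound continuous_on_time_slice[OF contP _ cd, of r] that
    by (intro integral_bound) auto
  show False
  proof (rule bounded_solution_log_growth[of k q "max R (max R1 r0)"])
    show "0 < q" using H0 by (simp add: q_def)
    fix r assume r: "max R (max R1 r0) < r"
    have "((\<lambda>r. Re (cnj (H r0) * X r)) has_vector_derivative
      Re (cnj (H r0) * (- (of_int k / of_real r * X r) + of_real (r powi (k - 1)) * H r))) (at r)"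
      by (intro bounded_linear.has_vector_derivative[OF bounded_linear_Re] has_vector_derivative_mult_right dX)
        (use r in auto)
    moreover have "Re (cnj (H r0) * (- (of_int k / of_real r * X r) + of_real (r powi (k - 1)) * H r)) =
      - (of_int k / r * Re (cnj (H r0) * X r)) + r powi (k - 1) * Re (cnj (H r0) * H r)"
    proof -
      have "cnj (H r0) * (- (of_int k / of_real r * X r) + of_real (r powi (k - 1)) * H r) =
        of_real (- (of_int k / r)) * (cnj (H r0) * X r) + of_real (r powi (k - 1)) * (cnj (H r0) * H r)"
        by (simp add: algebra_simps)
      then show ?thesis by (simp only: Re_complex_of_real Re_divide_of_real plus_complex.sel times_complex.sel Im_complex_of_real)
    qed
    ultimately show "((\<lambda>r. Re (cnj (H r0) * X r)) has_real_derivative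
       - (of_int k / r * Re (cnj (H r0) * X r)) + r powi (k - 1) * Re (cnj (H r0) * H r)) (at r)"
      by (simp only: has_real_derivative_iff_has_vector_derivative)
    show "q \<le> Re (cnj (H r0) * H r)" using R1[of r] r by auto
    have "\<bar>Re (cnj (H r0) * X r)\<bar> \<le> norm (cnj (H r0) * X r)" by (rule abs_Re_le_cmod)
    also have "\<dots> \<le> norm (H r0) * (B * (d - c))"
      unfolding norm_mult complex_mod_cnj using X_bound[of r] r by (intro mult_left_mono) auto
    finally show "\<bar>Re (cnj (H r0) * X r)\<bar> \<le> norm (H r0) * (B * (d - c))" .
  qed (use assms in auto)
qed

section \<open>The Robin condition for nonnegative modes\<close>

lemma has_vector_derivative_fourier_coeff_param:
  fixes h h' :: "real \<Rightarrow> real^2 \<Rightarrow> real"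
  assumes "continuous_on (T \<times> D) (\<lambda>(t, x). h t x)" "continuous_on (T \<times> D) (\<lambda>(t, x). h' t x)"
    "\<And>t x. t \<in> T \<Longrightarrow> x \<in> D \<Longrightarrow> ((\<lambda>t. h t x) has_real_derivative h' t x) (at t)"
    "open T" "convex T" "t \<in> T" "\<And>\<phi>. polar r \<phi> \<in> D"
  shows "((\<lambda>t. fourier_coeff k (h t) r) has_vector_derivative fourier_coeff k (h' t) r) (at t)"
proof -
  have slice: "continuous_on (T \<times> cbox 0 (2*pi)) (\<lambda>p. (\<lambda>(t, x). G t x) (fst p, polar r (snd p)))"
    if "continuous_on (T \<times> D) (\<lambda>(t, x). G t x)" for G :: "real \<Rightarrow> real^2 \<Rightarrow> real"
    by (rule continuous_on_compose2[OF that]) (use assms(7) in \<open>auto intro!: continuous_intros\<close>)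
  have "((\<lambda>t. integral (cbox 0 (2*pi)) (\<lambda>\<phi>. complex_of_real (h t (polar r \<phi>)) * cis (- (real_of_int k * \<phi>))))
    has_vector_derivative integral (cbox 0 (2*pi))
      (\<lambda>\<phi>. complex_of_real (h' t (polar r \<phi>)) * cis (- (real_of_int k * \<phi>)))) (at t within T)"
  proof (rule leibniz_rule_vector_derivative)
    fix s \<phi> assume "s \<in> T"
    then show "((\<lambda>t. complex_of_real (h t (polar r \<phi>)) * cis (- (real_of_int k * \<phi>))) has_vector_derivative
        complex_of_real (h' s (polar r \<phi>)) * cis (- (real_of_int k * \<phi>))) (at s within T)"
      using assms(7) by (intro has_vector_derivative_mult_left has_vector_derivative_of_real
        has_field_derivative_at_within[OF assms(3)])
    show "(\<lambda>\<phi>. complex_of_real (h s (polar r \<phi>)) * cis (- (real_of_int k * \<phi>))) integrable_on cbox 0 (2*pi)"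
    proof -
      have "continuous_on D (\<lambda>x. (\<lambda>(t, x). h t x) (s, x))"
        by (rule continuous_on_compose2[OF assms(1)]) (use \<open>s \<in> T\<close> in \<open>auto intro!: continuous_intros\<close>)
      from fourier_coeff_integrable[OF this assms(7)] show ?thesis
        by (simp add: cbox_interval)
    qed
  next
    show "continuous_on (T \<times> cbox 0 (2*pi))
      (\<lambda>(s, \<phi>). complex_of_real (h' s (polar r \<phi>)) * cis (- (real_of_int k * \<phi>)))"
      using slice[OF assms(2)] unfolding split_beta by (intro continuous_intros) simp
  qed (use assms in auto)
  then have "((\<lambda>t. integral {0..2*pi} (\<lambda>\<phi>. complex_of_real (h t (polar r \<phi>)) * cis (- (real_of_int k * \<phi>))))
    has_vector_derivative integral {0..2*pi}
      (\<lambda>\<phi>. complex_of_real (h' t (polar r \<phi>)) * cis (- (real_of_int k * \<phi>)))) (at t)"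
    using assms(4,6) by (simp add: cbox_interval at_within_open[of t T])
  from has_vector_derivative_mult_right[OF this, of "complex_of_real (1 / (2 * pi))"] show ?thesis
    unfolding fourier_coeff_def .
qed

lemma continuous_on_space_slice:
  assumes "continuous_on (T \<times> D) (\<lambda>(t, x). h t x)" "t \<in> T"
  shows "continuous_on D (h t)"
proof -
  have "continuous_on D (\<lambda>x. (\<lambda>(t, x). h t x) (t, x))"
    by (rule continuous_on_compose2[OF assms(1)]) (use assms(2) in \<open>auto intro!: continuous_intros\<close>)
  then show ?thesis by simp
qed

text \<open>Once \<open>V\<close> vanishes at \<open>r0\<close>, the relation
  \<open>P_r + k P / r = V\<close>, carried to the boundary, is the Robin condition. A nonzero value
  of \<open>V\<close> would persist for a short time, but on some subinterval of that time its mean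
  is zero.\<close>

lemma robin_condition_nonneg:
  fixes w :: "real \<Rightarrow> real^2 \<Rightarrow> real"
  assumes "0 < r0" "0 \<le> k" and heat: "heat_solution r0 w"
    and slip: "\<And>t. 0 < t \<Longrightarrow> no_slip_vorticity r0 vinf (w t)"
    and decay: "\<And>t. 0 < t \<Longrightarrow> (w t \<longlongrightarrow> 0) at_infinity"
    and "0 < t"
  shows "(fourier_coeff k (w t) has_vector_derivative
    - (of_int k / of_real r0 * fourier_coeff k (w t) r0)) (at r0 within {r0..})"
proof -
  have dt: "\<And>t x. 0 < t \<Longrightarrow> x \<in> exterior_dom r0 \<Longrightarrow> (\<lambda>s. w s x) differentiable (at t)"
    and dx: "\<And>t x. 0 < t \<Longrightarrow> x \<in> exterior_dom r0 \<Longrightarrow> w t differentiable (at x)"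
    and dxx: "\<And>t x j. 0 < t \<Longrightarrow> x \<in> exterior_dom r0 \<Longrightarrow> pd j (w t) differentiable (at x)"
    and cont_wt: "continuous_on ({0<..} \<times> exterior_dom r0) (\<lambda>(t, x). deriv (\<lambda>s. w s x) t)"
    and cont_wxx: "\<And>i j. continuous_on ({0<..} \<times> exterior_dom r0) (\<lambda>(t, x). pd i (pd j (w t)) x)"
    and cont_w: "continuous_on ({0<..} \<times> closed_exterior r0) (\<lambda>(t, x). w t x)"
    and eq: "\<And>t x. 0 < t \<Longrightarrow> x \<in> exterior_dom r0 \<Longrightarrow> deriv (\<lambda>s. w s x) t = laplacian2 (w t) x"
    using heat unfolding heat_solution_def by auto
  obtain g where cont_g: "\<And>j. continuous_on ({0<..} \<times> closed_exterior r0) (\<lambda>(t, x). g j t x)"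
    and g: "\<And>j t x. 0 < t \<Longrightarrow> x \<in> exterior_dom r0 \<Longrightarrow> g j t x = pd j (w t) x"
    using heat unfolding heat_solution_def by blast
  have C1: "C1_exterior r0 (w t)" "C1_exterior r0 (pd j (w t))" if "0 < t" for t j
  proof -
    \<comment> \<open>Continuity of the first partial derivatives is drawn from the extension
      \<open>g\<close>, with which they agree in the open domain.\<close>
    have "continuous_on (exterior_dom r0) (g i t)" for i
      by (rule continuous_on_subset[OF continuous_on_space_slice[OF cont_g] exterior_subset_closed])
        (use that in auto)
    then have "continuous_on (exterior_dom r0) (pd i (w t))" for i
      by (rule continuous_on_eq) (use g that in auto)
    then show "C1_exterior r0 (w t)" "C1_exterior r0 (pd j (w t))"
      using that dx dxx continuous_on_space_slice[OF cont_wxx] by (auto simp: C1_exterior_def)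
  qed
  define P where "P = (\<lambda>t. fourier_coeff k (w t))"
  define P' where "P' = (\<lambda>t. fourier_coeff k (\<lambda>x. deriv (\<lambda>s. w s x) t))"
  \<comment> \<open>Using \<open>g\<close> rather than \<open>pd\<close> makes \<open>V\<close>
    meaningful and continuous up to \<open>r0\<close>.\<close>
  define V where "V = (\<lambda>t r. fourier_coeff (k - 1) (g 1 t) r - \<i> * fourier_coeff (k - 1) (g 2 t) r)"
  have contP: "continuous_on ({0<..} \<times> {r0..}) (\<lambda>(t, r). P t r)"
    unfolding P_def by (rule continuous_on_fourier_coeff_param[OF cont_w]) (use assms(1) in auto)
  have contP_int: "continuous_on ({0<..} \<times> {r0<..}) (\<lambda>(t, r). P t r)"
    by (rule continuous_on_subset[OF contP]) auto
  have contP': "continuous_on ({0<..} \<times> {r0<..}) (\<lambda>(t, r). P' t r)"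
    unfolding P'_def by (rule continuous_on_fourier_coeff_param[OF cont_wt]) (use assms(1) in auto)
  have cont_gcoeff: "continuous_on ({0<..} \<times> {r0..}) (\<lambda>(t, r). fourier_coeff (k - 1) (g j t) r)" for j
    by (rule continuous_on_fourier_coeff_param[OF cont_g]) (use assms(1) in auto)
  have contV: "continuous_on ({0<..} \<times> {r0..}) (\<lambda>(t, r). V t r)"
    using cont_gcoeff unfolding V_def split_beta by (intro continuous_intros) auto
  have V: "V t r = fourier_coeff (k - 1) (pd 1 (w t)) r - \<i> * fourier_coeff (k - 1) (pd 2 (w t)) r"
    if "0 < t" "r0 < r" for t r
  proof -
    have "fourier_coeff (k - 1) (g j t) r = fourier_coeff (k - 1) (pd j (w t)) r" for j
      by (rule fourier_coeff_cong) (use g that assms(1) in auto)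
    then show ?thesis by (simp add: V_def)
  qed
  have dPt: "((\<lambda>t. P t r) has_vector_derivative P' t r) (at t)" if "0 < t" "r0 < r" for t r
    unfolding P_def P'_def
  proof (rule has_vector_derivative_fourier_coeff_param[of "{0<..}" "exterior_dom r0"])
    show "continuous_on ({0<..} \<times> exterior_dom r0) (\<lambda>(t, x). w t x)"
      using exterior_subset_closed by (intro continuous_on_subset[OF cont_w]) auto
    show "((\<lambda>t. w t x) has_real_derivative deriv (\<lambda>s. w s x) t) (at t)"
      if "t \<in> {0<..}" "x \<in> exterior_dom r0" for t x
      using dt[of t x] that by (simp add: DERIV_deriv_iff_real_differentiable)
  qed (use that cont_wt assms(1) in auto)
  have dPr: "(P t has_vector_derivative - (of_int k / of_real r * P t r) + V t r) (at r)"
    if "0 < t" "r0 < r" for t r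
    unfolding V[OF that] P_def
    by (rule has_vector_derivative_fourier_coeff(2)[OF assms(1) C1(1)[OF that(1)] that(2)])
  have dV: "(V t has_vector_derivative of_int (k - 1) / of_real r * V t r + P' t r) (at r)"
    if "0 < t" "r0 < r" for t r
  proof -
    have "P' t r = fourier_coeff k (laplacian2 (w t)) r"
      unfolding P'_def by (rule fourier_coeff_cong) (use eq that assms(1) in auto)
    with fourier_coeff_laplacian[OF assms(1) C1[OF that(1)] that(2), of k]
    have "((\<lambda>r. fourier_coeff (k - 1) (pd 1 (w t)) r - \<i> * fourier_coeff (k - 1) (pd 2 (w t)) r)
      has_vector_derivative of_int (k - 1) / of_real r * V t r + P' t r) (at r)"
      unfolding V[OF that] by simp
    then show ?thesis
      by (rule has_vector_derivative_transform_within_open[of _ _ _ "{r0<..}"]) (use V that in auto)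
  qed
  \<comment> \<open>One velocity field is chosen for each time; different times are compared only
    through the common limit of \<open>N\<close>.\<close>
  obtain v where v: "\<And>t. 0 < t \<Longrightarrow> curl_inverse r0 vinf (w t) (v t)" "\<And>t. 0 < t \<Longrightarrow> vanishes_on_circle r0 (v t)"
    using slip unfolding no_slip_vorticity_def by metis
  define N where "N = (\<lambda>t r. complex_of_real (r powi (1 - k)) *
    (\<i> * (fourier_coeff (k - 1) (\<lambda>x. v t x $ 1) r - \<i> * fourier_coeff (k - 1) (\<lambda>x. v t x $ 2) r)))"
  have contN: "continuous_on {r0..} (N t)" and N0: "N t r0 = 0"
    and limN: "(N t \<longlongrightarrow> (if k = 1 then \<i> * of_real vinf else 0)) at_top" if "0 < t" for t
    unfolding N_def using no_slip_moment(1,2,4)[OF assms(1,2) v[OF that]] by simp_all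
  have dN: "(N t has_vector_derivative of_real (r powi (1 - k)) * P t r) (at r)" if "0 < t" "r0 < r" for t r
    unfolding N_def P_def by (rule no_slip_moment(3)[OF assms(1,2) v[OF that(1)] that(2)])
  have flux: "V t r0 = 0" if "0 < t" for t
  proof (rule ccontr)
    assume nz: "V t r0 \<noteq> 0"
    have cont: "continuous_on {0<..} (\<lambda>s. V s r0)"
      by (rule continuous_on_time_slice[OF contV]) auto
    then have "isCont (\<lambda>s. V s r0) t"
      using that by (simp add: continuous_on_eq_continuous_at)
    \<comment> \<open>Within \<open>e\<close> of \<open>t\<close> the flux stays within half of its
      norm at \<open>t\<close>, so its mean there cannot vanish.\<close>
    then obtain e where e: "0 < e" "\<And>s. dist s t < e \<Longrightarrow> dist (V s r0) (V t r0) < norm (V t r0) / 2"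
      using nz unfolding continuous_at_eps_delta by (metis half_gt_zero zero_less_norm_iff)
    \<comment> \<open>For times in \<open>E n\<close> the bound \<open>1\<close> on \<open>w\<close>
      holds uniformly outside radius \<open>max r0 n\<close>. Decay at each time makes these closed
      sets cover the interval, so one of them contains a whole subinterval; \<open>e/2\<close> keeps
      it strictly inside the neighbourhood.\<close>
    define E where "E = (\<lambda>n::nat. \<Inter>x\<in>{x. max r0 n \<le> norm x}. {t..t + e/2} \<inter> (\<lambda>s. w s x) -` {-1..1})"
    have "closed (E n)" for n
      unfolding E_def
    proof (intro closed_INT ballI continuous_closed_preimage)
      fix x :: "real^2" assume "x \<in> {x. max r0 n \<le> norm x}"
      then have "continuous_on {0<..} (\<lambda>s. (\<lambda>(t, x). w t x) (s, x))"
        by (intro continuous_on_compose2[OF cont_w])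
          (auto intro!: continuous_intros simp: closed_exterior_def)
      then show "continuous_on {t..t + e/2} (\<lambda>s. w s x)"
        using that by (simp add: continuous_on_subset subset_iff)
    qed auto
    moreover have "{t..t + e/2} \<subseteq> (\<Union>n. E n)"
    proof
      fix s assume s: "s \<in> {t..t + e/2}"
      then have "eventually (\<lambda>x. dist (w s x) 0 < 1) at_infinity"
        using that by (intro tendstoD[OF decay]) auto
      then obtain b where b: "\<And>x. b \<le> norm x \<Longrightarrow> \<bar>w s x\<bar> < 1"
        by (auto simp: eventually_at_infinity)
      obtain n :: nat where "b \<le> n" using real_arch_simple by blast
      have "\<bar>w s x\<bar> \<le> 1" if "max r0 n \<le> norm x" for x
        using b[of x] that \<open>b \<le> n\<close> by auto
      then have "s \<in> E n"
        using s by (auto simp: E_def abs_le_iff)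
      then show "s \<in> (\<Union>n. E n)" by blast
    qed
    ultimately obtain n c d where cd: "t \<le> c" "c < d" "d \<le> t + e/2" "{c..d} \<subseteq> E n"
      by (rule Baire_interval[of t "t + e/2" E, rotated]) (use \<open>0 < e\<close> in auto)
    have zero: "integral {c..d} (\<lambda>s. V s r0) = 0"
    proof (rule zero_mean_flux[OF assms(1,2) _ cd(2) contP_int contP' contV dPt dPr dV
        contN N0 dN limN])
      fix s r assume "s \<in> {c..d}" and r: "max r0 n < r"
      then have s: "0 < s" "s \<in> E n" using cd that by auto
      show "norm (P s r) \<le> 1"
        unfolding P_def
      proof (rule norm_fourier_coeff_le[OF continuous_on_space_slice[OF cont_w]])
        show "\<bar>w s (polar r \<phi>)\<bar> \<le> 1" for \<phi>
        proof -
          have "polar r \<phi> \<in> {x. max r0 n \<le> norm x}" using r assms(1) by simp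
          with s(2) have "s \<in> (\<lambda>s. w s (polar r \<phi>)) -` {-1..1}" unfolding E_def by blast
          then show ?thesis by (simp add: abs_le_iff)
        qed
      qed (use s r assms(1) in auto)
    qed (use cd that in auto)
    have int: "(\<lambda>s. V s r0) integrable_on {c..d}"
      by (intro integrable_continuous_real continuous_on_subset[OF cont]) (use cd that in auto)
    \<comment> \<open>With zero mean of \<open>V\<close>, the mean deviation from
      \<open>V t r0\<close> has the full norm of \<open>V t r0\<close>, although half of it is an
      upper bound.\<close>
    have "norm (integral {c..d} (\<lambda>s. V s r0 - V t r0)) \<le> norm (V t r0) / 2 * (d - c)"
    proof (rule integral_bound)
      show "continuous_on {c..d} (\<lambda>s. V s r0 - V t r0)"
        by (intro continuous_intros continuous_on_subset[OF cont]) (use cd that in auto)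
      show "norm (V s r0 - V t r0) \<le> norm (V t r0) / 2" if "s \<in> {c..d}" for s
        using e(2)[of s] that cd e(1) by (auto simp: dist_norm)
    qed (use cd in auto)
    also have "integral {c..d} (\<lambda>s. V s r0 - V t r0) = - ((d - c) *\<^sub>R V t r0)"
      using cd(2) by (subst integral_diff) (auto simp: int zero)
    finally have "(d - c) * norm (V t r0) \<le> (d - c) * (norm (V t r0) / 2)"
      using cd(2) unfolding norm_minus_cancel norm_scaleR by (simp add: mult.commute)
    then show False
      using cd(2) nz by simp
  qed
  \<comment> \<open>\<open>E\<close> is now a different object: the integrating factor leaves a
    derivative containing \<open>V\<close> alone, continuous up to \<open>r0\<close> and zero
    there.\<close>
  define E where "E = (\<lambda>r. of_real (r powi k) * P t r)"
  have "(E has_vector_derivative of_real (r0 powi k) * V t r0) (at r0 within {r0..})"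
  proof (rule has_vector_derivative_boundary[where f' = "\<lambda>r. of_real (r powi k) * V t r"])
    have "continuous_on {r0..} (P t)" "continuous_on {r0..} (V t)"
      using continuous_on_space_slice[OF contP] continuous_on_space_slice[OF contV] \<open>0 < t\<close> by auto
    then show "continuous_on {r0..} E" "continuous_on {r0..} (\<lambda>r. of_real (r powi k) * V t r)"
      unfolding E_def using assms(1) by (auto intro!: continuous_intros)
    show "(E has_vector_derivative of_real (r powi k) * V t r) (at r)" if "r0 < r" for r
      unfolding E_def
      by (rule has_vector_derivative_weight[OF dPr]) (use assms that in auto)
  qed
  then have dE: "(E has_vector_derivative 0) (at r0 within {r0..})"
    by (simp add: flux[OF \<open>0 < t\<close>])
  \<comment> \<open>Multiplying by \<open>r powi (- k)\<close> returns to \<open>P t\<close>; as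
    \<open>E\<close> has zero derivative at \<open>r0\<close>, the derivative comes from this factor
    alone.\<close>
  have "((\<lambda>r. r powi (- k)) has_real_derivative of_int (- k) * r0 powi (- k - 1)) (at r0 within {r0..})"
    using assms(1) by (auto intro!: derivative_eq_intros)
  from has_vector_derivative_mult[OF has_vector_derivative_of_real[OF this] dE]
  have "((\<lambda>r. of_real (r powi (- k)) * E r) has_vector_derivative
      of_real (of_int (- k) * r0 powi (- k - 1)) * E r0) (at r0 within {r0..})"
    by simp
  moreover have "of_real (of_int (- k) * r0 powi (- k - 1)) * E r0 = - (of_int k / of_real r0 * P t r0)"
    using assms(1) by (simp add: E_def power_int_diff power_int_minus field_simps)
  ultimately have "((\<lambda>r. of_real (r powi (- k)) * E r) has_vector_derivative
      - (of_int k / of_real r0 * P t r0)) (at r0 within {r0..})"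
    by simp
  then have "(P t has_vector_derivative - (of_int k / of_real r0 * P t r0)) (at r0 within {r0..})"
    by (rule has_vector_derivative_transform[rotated 2])
      (use assms(1) in \<open>auto simp: E_def power_int_minus field_simps\<close>)
  then show ?thesis
    unfolding P_def .
qed

section \<open>Extension to all modes\<close>

theorem theorem3p2:
  fixes r0 vinf :: real
    and v0 :: "real^2 \<Rightarrow> real^2"
    and w :: "real \<Rightarrow> real^2 \<Rightarrow> real"
  assumes "r0 > 0"
    and "exterior_flow r0 vinf v0"
    and "vanishes_on_circle r0 v0"
    and "curl2 v0 absolutely_integrable_on exterior_dom r0"
    and "\<And>r. r > r0 \<Longrightarrow> fourier_series_converges (radial_comp v0) r"
    and "\<And>r. r > r0 \<Longrightarrow> fourier_series_converges (tangential_comp v0) r"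
    and "\<And>r. r > r0 \<Longrightarrow> fourier_series_converges (curl2 v0) r"
    and "\<And>k. (\<lambda>r. fourier_coeff k (curl2 v0) r * complex_of_real (sqrt r)) absolutely_integrable_on {r0<..}"
    and "heat_solution r0 w"
    and "has_initial_value r0 w (curl2 v0)"
    and "\<And>t. t > 0 \<Longrightarrow> no_slip_vorticity r0 vinf (w t)"
    and "\<And>t. t > 0 \<Longrightarrow> (w t \<longlongrightarrow> 0) at_infinity"
  shows "\<forall>t>0. \<forall>k. \<exists>D::complex.
    (fourier_coeff k (w t) has_vector_derivative D) (at r0 within {r0..}) \<and>
    complex_of_real r0 * D + of_int \<bar>k\<bar> * fourier_coeff k (w t) r0 = 0"
proof (intro allI impI)
  fix t :: real and k :: int assume "0 < t"
  have robin: "(fourier_coeff m (w t) has_vector_derivative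
      - (of_int m / of_real r0 * fourier_coeff m (w t) r0)) (at r0 within {r0..})" if "0 \<le> m" for m
    using robin_condition_nonneg[OF assms(1) that assms(9,11,12) \<open>0 < t\<close>] by simp
  have "(fourier_coeff k (w t) has_vector_derivative
      - (of_int \<bar>k\<bar> / of_real r0 * fourier_coeff k (w t) r0)) (at r0 within {r0..})"
  proof (cases "0 \<le> k")
    \<comment> \<open>Here \<open>- k\<close> is the absolute value of \<open>k\<close>, and the
      factor in front of the coefficient is real, so conjugation affects the coefficient
      only.\<close>
    case False
    then have "((\<lambda>r. cnj (fourier_coeff (- k) (w t) r)) has_vector_derivative
        cnj (- (of_int (- k) / of_real r0 * fourier_coeff (- k) (w t) r0))) (at r0 within {r0..})"
      by (intro bounded_linear.has_vector_derivative[OF bounded_linear_cnj] robin) simp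
    then show ?thesis
      using False by (simp add: fourier_coeff_uminus)
  qed (use robin in simp)
  moreover have "complex_of_real r0 * - (of_int \<bar>k\<bar> / of_real r0 * fourier_coeff k (w t) r0) +
      of_int \<bar>k\<bar> * fourier_coeff k (w t) r0 = 0"
    using assms(1) by simp
  ultimately show "\<exists>D::complex.
    (fourier_coeff k (w t) has_vector_derivative D) (at r0 within {r0..}) \<and>
    complex_of_real r0 * D + of_int \<bar>k\<bar> * fourier_coeff k (w t) r0 = 0"
    by blast
qed

end
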